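(* Let $X=(X_1,X_2)$ be a random vector in $\mathbb{R}^2$ with $\mathbb{E}[X_i]=0$ and $\mathbb{E}[X_iX_j]=\delta_{ij}$ for $i,j\in\{1,2\}$, and let $S(n)=(S_1(n),S_2(n))=X(1)+\dots+X(n)$, where $X(1),X(2),\dots$ are independent copies of $X$. Assume that there is a two-dimensional lattice $R\subset\mathbb{R}^2$ with $\mathbb{P}(S(n)\in R\text{ for all }n)=1$, and that, for every $x\in R\cap K_\alpha$, almost surely $x+S(\tau_x)\in\partial K_\alpha$. (a) If $0<\alpha<\pi$, then for all $x\in K_\alpha\cap R$, $$\mathbb{E}[x_1+S_1(\tau_x)]=x_1,\qquad \mathbb{E}[x_2+S_2(\tau_x)]=x_2.$$ (b) If $0<\alpha<\pi/2$, then for all $x\in K_\alpha\cap R$, $$\mathbb{E}[(x_1+S_1(\tau_x))^2]=x_1^2+x_2(x_1\tan\alpha-x_2),\qquad \mathbb{E}[(x_2+S_2(\tau_x))^2]=x_2^2+x_2(x_1\tan\alpha-x_2).$$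
   Context: $K_\alpha:=\{(r\cos\varphi,r\sin\varphi):r>0,\ 0<\varphi<\alpha\}$ is the open wedge of opening $\alpha$ with vertex at the origin. For $x=(x_1,x_2)\in K_\alpha$, $\tau_x:=\inf\{n\ge1:x+S(n)\notin K_\alpha\}$. *)

theory Defs
  imports "HOL-Probability.Probability"
begin

definition wedge :: "real \<Rightarrow> (real^2) set" where
  "wedge \<alpha> = {vector [r * cos \<phi>, r * sin \<phi>] | r \<phi>. 0 < r \<and> 0 < \<phi> \<and> \<phi> < \<alpha>}"

(* The condition u \<noteq> v is needed: for u = v the set {u, v} is a singleton. *)
definition planar_lattice :: "(real^2) set \<Rightarrow> bool" where
  "planar_lattice R \<longleftrightarrow>
     (\<exists>u v. u \<noteq> v \<and> independent {u, v} \<and>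
            R = {of_int m *\<^sub>R u + of_int n *\<^sub>R v | m n :: int. True})"

(* The walk starts at 0; only the steps with index at least 1 are used. *)
definition walk :: "(nat \<Rightarrow> 'a \<Rightarrow> real^2) \<Rightarrow> nat \<Rightarrow> 'a \<Rightarrow> real^2" where
  "walk Y n \<omega> = (\<Sum>i=1..n. Y i \<omega>)"

(* The value is \<infinity> (the infimum of the empty set) if the path never leaves K. *)
definition exit_time ::
    "(real^2) set \<Rightarrow> (nat \<Rightarrow> 'a \<Rightarrow> real^2) \<Rightarrow> real^2 \<Rightarrow> 'a \<Rightarrow> enat" where
  "exit_time K S x \<omega> = Inf (enat ` {n. 1 \<le> n \<and> x + S n \<omega> \<notin> K})"

(* Only meaningful where the exit time is finite. *)
definition exit_position ::
    "(real^2) set \<Rightarrow> (nat \<Rightarrow> 'a \<Rightarrow> real^2) \<Rightarrow> real^2 \<Rightarrow> 'a \<Rightarrow> real^2" where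
  "exit_position K S x \<omega> = x + S (the_enat (exit_time K S x \<omega>)) \<omega>"

end

theory Submission
  imports Defs
begin

text \<open>Stop the walk at its first exit from the wedge \<open>K\<close> and call the stopped walk \<open>Z n\<close>. Because exits
happen through the boundary, \<open>Z n\<close> never leaves the closed wedge, and it is eventually equal to
the exit position. The moments of \<open>Z n\<close> itself are elementary: each coordinate is a martingale,
and with \<open>c n\<close> the expected number of steps made up to time \<open>n\<close>, the matrix of mean products of the
coordinates of \<open>Z m - Z n\<close> is \<open>c m - c n\<close> times the identity for \<open>n \<le> m\<close>. What has
to be shown is that these identities survive the passage to the limit, that is, uniform integrability.

\<^bold>\<open>Second moments, acute angle.\<close> The quadratic form \<open>u z = z$2 * (z$1 * tan \<alpha> - z$2)\<close> is
nonnegative on the closed wedge and vanishes on its boundary, being a multiple of the product of the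
distances to the two sides. The mean of \<open>u (Z n)\<close> is \<open>u x - c n\<close> and nonnegative, so
\<open>c n\<close> is bounded, the stopped walk is Cauchy in mean square, and the second moments converge
(\<open>second_moments_of_limit\<close>). The limit of \<open>c n\<close> is then \<open>u x\<close>, because \<open>u\<close> vanishes at the exit position.

\<^bold>\<open>First moments, angle below \<open>pi\<close>.\<close> Here \<open>c n\<close> may be unbounded, and
the steps have only two moments. Let \<open>y\<close> be the coordinate along the axis of the wedge, shifted
by a large constant, and \<open>w\<close> the coordinate across it; in the wedge \<open>\<bar>w\<bar> \<le> T * y\<close> for some
\<open>T\<close>. The function \<open>g = y * ln y / 4 - w\<^sup>2 / y\<close> has negative Laplacian, since the Laplacian of \<open>y * ln y\<close>
is \<open>1 / y\<close> while that of \<open>w\<^sup>2 / y\<close> is at least \<open>2 / y\<close>. The first summand is superlinear and the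
second is at most linear in \<open>y\<close>, so \<open>g\<close> outgrows every multiple of the norm. The error of
replacing the increment of \<open>g\<close> over a step by its second-order expansion can be controlled with two moments,
because \<open>ln (1 + s) \<le> s\<close> and because \<open>w\<^sup>2 / y\<close> has an explicit convexity remainder
(\<open>drift_inequality\<close>). Hence \<open>g\<close> decreases in mean along the stopped walk once the shift is large
(\<open>lyapunov_step\<close>), the mean of \<open>y * ln y\<close> stays bounded, and the stopped walk is uniformly
integrable (\<open>first_moment_of_limit\<close>).\<close>

section \<open>Convergence of means under uniform integrability\<close>

lemma integral_le_of_nn_integral_le:
  fixes f :: "'a \<Rightarrow> real"
  assumes [measurable]: "f \<in> borel_measurable M" and nn: "AE x in M. 0 \<le> f x"
    and le: "(\<integral>\<^sup>+x. ennreal (f x) \<partial>M) \<le> ennreal c" and c: "0 \<le> c"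
  shows "integrable M f \<and> integral\<^sup>L M f \<le> c"
proof
  show i: "integrable M f"
    using le nn by (intro integrableI_nonneg) (auto intro: le_less_trans)
  have "ennreal (integral\<^sup>L M f) \<le> ennreal c"
    using le nn_integral_eq_integral[OF i nn] by simp
  then show "integral\<^sup>L M f \<le> c" using c by (auto simp: ennreal_le_iff2)
qed

lemma fatou_real:
  fixes f :: "nat \<Rightarrow> 'a \<Rightarrow> real"
  assumes int: "\<And>n. integrable M (f n)" and nn: "\<And>n x. 0 \<le> f n x"
    and g[measurable]: "g \<in> borel_measurable M" 
    and lim: "AE x in M. (\<lambda>n. f n x) \<longlonglongrightarrow> g x"
    and le: "\<forall>\<^sub>F n in sequentially. integral\<^sup>L M (f n) \<le> c"
  shows "integrable M g \<and> integral\<^sup>L M g \<le> c"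
proof (rule integral_le_of_nn_integral_le)
  have [measurable]: "f n \<in> borel_measurable M" for n using int by auto
  show "g \<in> borel_measurable M" by fact
  show "AE x in M. 0 \<le> g x"
    using lim by eventually_elim (auto intro: LIMSEQ_le_const nn)
  obtain n where "integral\<^sup>L M (f n) \<le> c" using le eventually_happens'[of sequentially] by fastforce
  moreover have "0 \<le> integral\<^sup>L M (f n)" by (simp add: nn)
  ultimately show c: "0 \<le> c" by linarith
  have "(\<integral>\<^sup>+x. ennreal (g x) \<partial>M) = (\<integral>\<^sup>+x. liminf (\<lambda>n. ennreal (f n x)) \<partial>M)"
  proof (rule nn_integral_cong_AE, use lim in eventually_elim)
    fix x assume "(\<lambda>n. f n x) \<longlonglongrightarrow> g x"
    then have "(\<lambda>n. ennreal (f n x)) \<longlonglongrightarrow> ennreal (g x)" by (rule tendsto_ennrealI)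
    then show "ennreal (g x) = liminf (\<lambda>n. ennreal (f n x))" by (metis lim_imp_Liminf sequentially_bot)
  qed
  also have "\<dots> \<le> liminf (\<lambda>n. \<integral>\<^sup>+x. ennreal (f n x) \<partial>M)" by (rule nn_integral_liminf) auto
  also have "\<dots> \<le> liminf (\<lambda>n. ennreal c)"
    using le by (intro Liminf_mono, eventually_elim) (simp add: nn_integral_eq_integral int nn ennreal_leI)
  also have "\<dots> = ennreal c" by (simp add: Liminf_const)
  finally show "(\<integral>\<^sup>+x. ennreal (g x) \<partial>M) \<le> ennreal c" .
qed

definition clip :: "real \<Rightarrow> real \<Rightarrow> real" where
  "clip G a = max (- G) (min G a)"

text \<open>Uniform integrability appears as domination up to a small error: for every \<open>\<epsilon>\<close>
one integrable \<open>G\<close> dominates all late \<open>A n\<close> except for an excess of mean at most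
\<open>\<epsilon>\<close>. This form covers both later uses, where \<open>G\<close> is a constant in one case and
an earlier term of the sequence in the other. Clipping at \<open>G\<close> reduces the claim to
dominated convergence; the clipping error of the limit is handled by Fatou's lemma.\<close>
lemma expectation_tendsto_of_uniformly_integrable:
  fixes A :: "nat \<Rightarrow> 'a \<Rightarrow> real"
  assumes int: "\<And>n. integrable M (A n)"
    and B[measurable]: "B \<in> borel_measurable M" 
    and lim: "AE x in M. (\<lambda>n. A n x) \<longlonglongrightarrow> B x"
    and ui: "\<And>\<epsilon>. 0 < \<epsilon> \<Longrightarrow> \<exists>G. integrable M G \<and> (\<forall>x. 0 \<le> G x) \<and>
       (\<forall>\<^sub>F n in sequentially. \<exists>\<Phi>. integrable M \<Phi> \<and> integral\<^sup>L M \<Phi> \<le> \<epsilon> \<and>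
          (AE x in M. 0 \<le> \<Phi> x \<and> \<bar>A n x\<bar> \<le> G x + \<Phi> x))"
  shows "integrable M B \<and> (\<lambda>n. integral\<^sup>L M (A n)) \<longlonglongrightarrow> integral\<^sup>L M B"
proof -
  have [measurable]: "A n \<in> borel_measurable M" for n using int by auto
  have key: "integrable M B \<and> (\<forall>\<^sub>F n in sequentially. \<bar>integral\<^sup>L M (A n) - integral\<^sup>L M B\<bar> < 3 * \<epsilon>)"
    if \<epsilon>: "0 < \<epsilon>" for \<epsilon>
  proof -
    obtain G where G: "integrable M G" "\<And>x. 0 \<le> G x"
      and ev: "\<forall>\<^sub>F n in sequentially. \<exists>\<Phi>. integrable M \<Phi> \<and> integral\<^sup>L M \<Phi> \<le> \<epsilon> \<and>
          (AE x in M. 0 \<le> \<Phi> x \<and> \<bar>A n x\<bar> \<le> G x + \<Phi> x)"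
      using ui[OF \<epsilon>] by blast
    have [measurable]: "G \<in> borel_measurable M" using G by auto
    define c where "c n x = clip (G x) (A n x)" for n x
    define d where "d x = clip (G x) (B x)" for x
    have [measurable]: "c n \<in> borel_measurable M" "d \<in> borel_measurable M" for n
      unfolding c_def d_def clip_def by measurable
    have bc: "\<bar>c n x\<bar> \<le> G x" and bd: "\<bar>d x\<bar> \<le> G x" for n x
      using G(2)[of x] by (auto simp: c_def d_def clip_def)
    have lc: "AE x in M. (\<lambda>n. c n x) \<longlonglongrightarrow> d x"
      using lim unfolding c_def d_def clip_def by eventually_elim (intro tendsto_intros)
    have ic: "integrable M (c n)" for n
      by (rule Bochner_Integration.integrable_bound[OF G(1)]) (use bc G(2) in auto)
    have id: "integrable M d"
      by (rule Bochner_Integration.integrable_bound[OF G(1)]) (use bd G(2) in auto)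
    have tc: "(\<lambda>n. integral\<^sup>L M (c n)) \<longlonglongrightarrow> integral\<^sup>L M d"
      by (rule integral_dominated_convergence[OF _ _ G(1) lc]) (use bc in auto)
    have ev2: "\<forall>\<^sub>F n in sequentially. integral\<^sup>L M (\<lambda>x. \<bar>A n x - c n x\<bar>) \<le> \<epsilon>"
      using ev
    proof eventually_elim
      fix n assume "\<exists>\<Phi>. integrable M \<Phi> \<and> integral\<^sup>L M \<Phi> \<le> \<epsilon> \<and>
          (AE x in M. 0 \<le> \<Phi> x \<and> \<bar>A n x\<bar> \<le> G x + \<Phi> x)"
      then obtain \<Phi> where \<Phi>: "integrable M \<Phi>" "integral\<^sup>L M \<Phi> \<le> \<epsilon>"
        "AE x in M. 0 \<le> \<Phi> x \<and> \<bar>A n x\<bar> \<le> G x + \<Phi> x" by blast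
      have "integral\<^sup>L M (\<lambda>x. \<bar>A n x - c n x\<bar>) \<le> integral\<^sup>L M \<Phi>"
      proof (rule integral_mono_AE)
        show "AE x in M. \<bar>A n x - c n x\<bar> \<le> \<Phi> x"
          using \<Phi>(3)
        proof eventually_elim
          fix x assume "0 \<le> \<Phi> x \<and> \<bar>A n x\<bar> \<le> G x + \<Phi> x"
          then show "\<bar>A n x - c n x\<bar> \<le> \<Phi> x" using G(2)[of x]
            unfolding c_def clip_def by linarith
        qed
      qed (use int ic \<Phi>(1) in auto)
      then show "integral\<^sup>L M (\<lambda>x. \<bar>A n x - c n x\<bar>) \<le> \<epsilon>" using \<Phi>(2) by simp
    qed
    have F: "integrable M (\<lambda>x. \<bar>B x - d x\<bar>) \<and> integral\<^sup>L M (\<lambda>x. \<bar>B x - d x\<bar>) \<le> \<epsilon>"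
    proof (rule fatou_real[where f = "\<lambda>n x. \<bar>A n x - c n x\<bar>"])
      show "AE x in M. (\<lambda>n. \<bar>A n x - c n x\<bar>) \<longlonglongrightarrow> \<bar>B x - d x\<bar>"
        using lim lc by eventually_elim (intro tendsto_intros)
    qed (use int ic ev2 in auto)
    have iBd: "integrable M (\<lambda>x. B x - d x)"
      by (rule Bochner_Integration.integrable_bound[OF conjunct1[OF F]]) auto
    from Bochner_Integration.integrable_add[OF this id] have iB: "integrable M B" by simp
    have "\<forall>\<^sub>F n in sequentially. \<bar>integral\<^sup>L M (c n) - integral\<^sup>L M d\<bar> < \<epsilon>"
      using tendstoD[OF tc \<epsilon>] by (simp add: dist_real_def)
    with ev2 have "\<forall>\<^sub>F n in sequentially. \<bar>integral\<^sup>L M (A n) - integral\<^sup>L M B\<bar> < 3 * \<epsilon>"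
    proof eventually_elim
      fix n assume 1: "integral\<^sup>L M (\<lambda>x. \<bar>A n x - c n x\<bar>) \<le> \<epsilon>"
        and 2: "\<bar>integral\<^sup>L M (c n) - integral\<^sup>L M d\<bar> < \<epsilon>"
      have "\<bar>integral\<^sup>L M (\<lambda>x. A n x - c n x)\<bar> \<le> integral\<^sup>L M (\<lambda>x. \<bar>A n x - c n x\<bar>)"
        by (rule integral_abs_bound)
      moreover have "\<bar>integral\<^sup>L M (\<lambda>x. B x - d x)\<bar> \<le> integral\<^sup>L M (\<lambda>x. \<bar>B x - d x\<bar>)"
        by (rule integral_abs_bound)
      moreover have "integral\<^sup>L M (\<lambda>x. A n x - c n x) = integral\<^sup>L M (A n) - integral\<^sup>L M (c n)"
        by (simp add: int ic)
      moreover have "integral\<^sup>L M (\<lambda>x. B x - d x) = integral\<^sup>L M B - integral\<^sup>L M d"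
        by (simp add: iB id)
      ultimately show "\<bar>integral\<^sup>L M (A n) - integral\<^sup>L M B\<bar> < 3 * \<epsilon>"
        using 1 2 conjunct2[OF F] \<epsilon> by linarith
    qed
    with iB show ?thesis by simp
  qed
  have "(\<lambda>n. integral\<^sup>L M (A n)) \<longlonglongrightarrow> integral\<^sup>L M B"
  proof (rule tendstoI)
    fix e :: real assume "0 < e"
    then show "\<forall>\<^sub>F n in sequentially. dist (integral\<^sup>L M (A n)) (integral\<^sup>L M B) < e"
      using key[of "e / 3"] by (simp add: dist_real_def)
  qed
  then show ?thesis using key[of 1] by simp
qed

section \<open>Two inequalities for the function y ln y\<close>

text \<open>The right-hand side is the second-order expansion of \<open>y ln y / 4 - w\<^sup>2 / y\<close>, except that the
logarithmic part carries the full \<open>\<xi>\<^sup>2 / y\<close> instead of half of it, and the convex part carries only half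
of its second-order term. The first loss comes from \<open>ln (1 + s) \<le> s\<close>. The second arises
because the exact remainder of \<open>w\<^sup>2 / y\<close> is \<open>(\<eta> - m \<xi>)\<^sup>2 / (y + \<xi>)\<close>, which is compared with the same
numerator over \<open>2 y\<close> when \<open>\<bar>\<xi>\<bar> \<le> b \<le> y\<close> and is dropped otherwise, at the cost of the last summand.\<close>
lemma drift_inequality:
  fixes y \<xi> w \<eta> b T :: real
  defines "m \<equiv> w / y"
  assumes y: "0 < y" "b \<le> y" "0 < y + \<xi>" and w: "\<bar>w\<bar> \<le> T * y"
  shows "(y + \<xi>) * ln (y + \<xi>) / 4 - (w + \<eta>)\<^sup>2 / (y + \<xi>)
     \<le> y * ln y / 4 - w\<^sup>2 / y
       + (((1 + ln y) / 4 + m\<^sup>2) * \<xi> - 2 * m * \<eta> + (1/4 - m\<^sup>2 / 2) / y * \<xi>\<^sup>2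
          - 1 / (2 * y) * \<eta>\<^sup>2 + m / y * (\<xi> * \<eta>)
          + (1 + T\<^sup>2) / (2 * y) * (if b < \<bar>\<xi>\<bar> then \<xi>\<^sup>2 + \<eta>\<^sup>2 else 0))"
proof -
  have w_eq: "w = m * y" using y by (simp add: m_def)
  have m: "m\<^sup>2 \<le> T\<^sup>2"
  proof -
    have "\<bar>m\<bar> \<le> T" using w y by (simp add: m_def abs_mult divide_le_eq)
    then show ?thesis by (metis abs_ge_zero power2_abs power_mono)
  qed
  have "ln ((y + \<xi>) / y) \<le> (y + \<xi>) / y - 1" using y by (intro ln_le_minus_one) auto
  moreover have "ln ((y + \<xi>) / y) = ln (y + \<xi>) - ln y" using y by (simp add: ln_divide_pos)
  moreover have "(y + \<xi>) / y - 1 = \<xi> / y" using y by (simp add: field_simps)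
  ultimately have "ln (y + \<xi>) \<le> ln y + \<xi> / y" by linarith
  then have "(y + \<xi>) * ln (y + \<xi>) \<le> (y + \<xi>) * (ln y + \<xi> / y)" using y by simp
  also have "\<dots> = y * ln y + (1 + ln y) * \<xi> + \<xi>\<^sup>2 / y" using y by (simp add: field_simps power2_eq_square)
  finally have 1: "(y + \<xi>) * ln (y + \<xi>) \<le> y * ln y + (1 + ln y) * \<xi> + \<xi>\<^sup>2 / y" .
  have 2: "(w + \<eta>)\<^sup>2 / (y + \<xi>) = w\<^sup>2 / y + 2 * m * \<eta> - m\<^sup>2 * \<xi> + (\<eta> - m * \<xi>)\<^sup>2 / (y + \<xi>)"
    using y by (simp add: w_eq field_simps power2_eq_square)
  have 3: "(\<eta> - m * \<xi>)\<^sup>2 / (y + \<xi>) \<ge>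
     (\<eta> - m * \<xi>)\<^sup>2 / (2 * y) - (1 + T\<^sup>2) / (2 * y) * (if b < \<bar>\<xi>\<bar> then \<xi>\<^sup>2 + \<eta>\<^sup>2 else 0)"
  proof (cases "b < \<bar>\<xi>\<bar>")
    case True
    have "(\<eta> - m * \<xi>)\<^sup>2 \<le> (1 + m\<^sup>2) * (\<xi>\<^sup>2 + \<eta>\<^sup>2)"
    proof -
      have "(1 + m\<^sup>2) * (\<xi>\<^sup>2 + \<eta>\<^sup>2) - (\<eta> - m * \<xi>)\<^sup>2 = (\<xi> + m * \<eta>)\<^sup>2" by (simp add: algebra_simps power2_eq_square)
      then show ?thesis by (smt (verit) zero_le_power2)
    qed
    also have "\<dots> \<le> (1 + T\<^sup>2) * (\<xi>\<^sup>2 + \<eta>\<^sup>2)" using m by (intro mult_right_mono) auto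
    finally have "(\<eta> - m * \<xi>)\<^sup>2 / (2 * y) \<le> (1 + T\<^sup>2) * (\<xi>\<^sup>2 + \<eta>\<^sup>2) / (2 * y)"
      using y by (intro divide_right_mono) auto
    moreover have "0 \<le> (\<eta> - m * \<xi>)\<^sup>2 / (y + \<xi>)" using y by simp
    ultimately show ?thesis using True by simp
  next
    case False
    then have "(\<eta> - m * \<xi>)\<^sup>2 / (2 * y) \<le> (\<eta> - m * \<xi>)\<^sup>2 / (y + \<xi>)"
      using y by (intro divide_left_mono) auto
    then show ?thesis using False by simp
  qed
  have 4: "(\<eta> - m * \<xi>)\<^sup>2 / (2 * y) = m\<^sup>2 / 2 / y * \<xi>\<^sup>2 + 1 / (2 * y) * \<eta>\<^sup>2 - m / y * (\<xi> * \<eta>)"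
    using y by (simp add: field_simps power2_eq_square)
  have 5: "(1/4 - m\<^sup>2 / 2) / y * \<xi>\<^sup>2 = \<xi>\<^sup>2 / y / 4 - m\<^sup>2 / 2 / y * \<xi>\<^sup>2"
    by (simp add: diff_divide_distrib left_diff_distrib)
  have 6: "((1 + ln y) / 4 + m\<^sup>2) * \<xi> = (1 + ln y) * \<xi> / 4 + m\<^sup>2 * \<xi>" by (simp add: algebra_simps)
  (* The products are generalised to variables, so that only linear arithmetic is left. *)
  have combine: "A / 4 - W \<le> A0 / 4 - W0 + (L / 4 + u - v + (Q / 4 - h) - k + p + q)"
    if "A \<le> A0 + L + Q" "W = W0 + v - u + D" "h + k - p - q \<le> D"
    for A A0 L Q W W0 u v D h k p q :: real
    using that by linarith
  show ?thesis unfolding 5 6 by (rule combine[OF 1 2 3[unfolded 4]])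
qed

lemma superlinear_bound:
  fixes y \<epsilon> :: real
  assumes "0 < \<epsilon>" "1 \<le> y"
  shows "y \<le> exp (1 / \<epsilon>) + \<epsilon> * (y * ln y)"
proof (cases "y \<le> exp (1 / \<epsilon>)")
  case True then show ?thesis using assms by (simp add: add_increasing2)
next
  case False
  then have "ln y \<ge> 1 / \<epsilon>" using assms by (subst ln_ge_iff) auto
  then have "\<epsilon> * ln y \<ge> 1" using assms by (simp add: field_simps)
  then have "y * 1 \<le> y * (\<epsilon> * ln y)" using assms by (intro mult_left_mono) auto
  moreover have "0 < exp (1 / \<epsilon>)" by simp
  moreover have "y * (\<epsilon> * ln y) = \<epsilon> * (y * ln y)" by simp
  ultimately show ?thesis by linarith
qed

section \<open>Geometry of the wedge\<close>

lemma wedge_eq: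
  assumes "0 < \<alpha>" "\<alpha> < pi"
  shows "wedge \<alpha> = {z. 0 < z $ 2 \<and> 0 < z $ 1 * sin \<alpha> - z $ 2 * cos \<alpha>}"
proof safe
  fix z assume "z \<in> wedge \<alpha>"
  then obtain r \<phi> where z: "z = vector [r * cos \<phi>, r * sin \<phi>]" "0 < r" "0 < \<phi>" "\<phi> < \<alpha>"
    by (auto simp: wedge_def)
  show "0 < z $ 2" using z assms by (simp add: sin_gt_zero)
  have "z $ 1 * sin \<alpha> - z $ 2 * cos \<alpha> = r * sin (\<alpha> - \<phi>)"
    by (simp add: z sin_diff algebra_simps)
  also have "\<dots> > 0" using z assms by (intro mult_pos_pos sin_gt_zero) auto
  finally show "0 < z $ 1 * sin \<alpha> - z $ 2 * cos \<alpha>" .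
next
  fix z :: "real^2" assume z: "0 < z $ 2" "0 < z $ 1 * sin \<alpha> - z $ 2 * cos \<alpha>"
  define c where "c = Complex (z $ 1) (z $ 2)"
  define r \<phi> where "r = norm c" and "\<phi> = Arg c"
  have c0: "c \<noteq> 0" using z by (auto simp: c_def complex_eq_iff)
  have c: "c = complex_of_real r * exp (\<i> * complex_of_real \<phi>)"
    unfolding r_def \<phi>_def using Arg_eq[OF c0] .
  have r: "0 < r" using c0 by (simp add: r_def)
  have "Re c = r * cos \<phi>" "Im c = r * sin \<phi>" by (simp_all add: c Re_exp Im_exp)
  then have z12: "z $ 1 = r * cos \<phi>" "z $ 2 = r * sin \<phi>" by (simp_all add: c_def)
  have s: "0 < sin \<phi>" using z r by (simp add: z12 zero_less_mult_iff)
  have bnd: "-pi < \<phi>" "\<phi> \<le> pi" unfolding \<phi>_def using mpi_less_Arg Arg_le_pi by auto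
  have "0 < \<phi>" 
  proof (rule ccontr)
    assume "\<not> 0 < \<phi>"
    then have "0 \<le> sin (- \<phi>)" using bnd by (intro sin_ge_zero) auto
    then show False using s by simp
  qed
  moreover have "\<phi> < \<alpha>"
  proof (rule ccontr)
    assume "\<not> \<phi> < \<alpha>"
    then have "0 \<le> sin (\<phi> - \<alpha>)" using bnd assms by (intro sin_ge_zero) auto
    then have "0 \<le> r * sin (\<phi> - \<alpha>)" using r by simp
    then show False using z(2) by (simp add: z12 sin_diff algebra_simps)
  qed
  moreover have "z = vector [r * cos \<phi>, r * sin \<phi>]" by (simp add: vec_eq_iff forall_2 z12)
  ultimately show "z \<in> wedge \<alpha>" using r by (auto simp: wedge_def)
qed

lemma open_wedge:
  assumes "0 < \<alpha>" "\<alpha> < pi"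
  shows "open (wedge \<alpha>)"
  unfolding wedge_eq[OF assms] by (intro open_Collect_conj open_Collect_less continuous_intros)

lemma closure_wedge:
  assumes "0 < \<alpha>" "\<alpha> < pi" "z \<in> closure (wedge \<alpha>)"
  shows "0 \<le> z $ 2 \<and> 0 \<le> z $ 1 * sin \<alpha> - z $ 2 * cos \<alpha>"
proof -
  have "closed {z::real^2. 0 \<le> z $ 2 \<and> 0 \<le> z $ 1 * sin \<alpha> - z $ 2 * cos \<alpha>}"
    by (intro closed_Collect_conj closed_Collect_le continuous_intros)
  moreover have "wedge \<alpha> \<subseteq> {z. 0 \<le> z $ 2 \<and> 0 \<le> z $ 1 * sin \<alpha> - z $ 2 * cos \<alpha>}"
    unfolding wedge_eq[OF assms(1,2)] by auto
  ultimately show ?thesis using assms(3) closure_minimal by blast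
qed

text \<open>For an acute angle the product is, up to the factor \<open>cos \<alpha>\<close>, the quadratic form whose drift along the walk is \<open>-1\<close> per step.\<close>
lemma frontier_wedge:
  assumes "0 < \<alpha>" "\<alpha> < pi" "z \<in> frontier (wedge \<alpha>)"
  shows "z $ 2 * (z $ 1 * sin \<alpha> - z $ 2 * cos \<alpha>) = 0"
proof -
  have "z \<in> closure (wedge \<alpha>)" "z \<notin> wedge \<alpha>"
    using assms open_wedge[OF assms(1,2)] by (auto simp: frontier_def interior_open)
  then show ?thesis using closure_wedge[OF assms(1,2)] unfolding wedge_eq[OF assms(1,2)] by force
qed

text \<open>A wedge of angle less than \<open>pi\<close> is a proper cone around its axis: at angle \<open>\<theta>\<close> from the axis the ratio of
transversal to axial coordinate is at most \<open>1 / cos \<theta>\<close>, and \<open>\<bar>\<theta>\<bar> \<le> \<alpha> / 2 < pi / 2\<close>.\<close>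
lemma closure_wedge_axis:
  assumes "0 < \<alpha>" "\<alpha> < pi" "z \<in> closure (wedge \<alpha>)"
  shows "\<bar>z \<bullet> vector [- sin (\<alpha>/2), cos (\<alpha>/2)]\<bar> \<le> (z \<bullet> vector [cos (\<alpha>/2), sin (\<alpha>/2)]) / cos (\<alpha>/2)"
proof -
  have pos: "0 < cos (\<alpha>/2)" using assms by (intro cos_gt_zero_pi) auto
  let ?C = "{z::real^2. \<bar>z \<bullet> vector [- sin (\<alpha>/2), cos (\<alpha>/2)]\<bar> \<le> (z \<bullet> vector [cos (\<alpha>/2), sin (\<alpha>/2)]) / cos (\<alpha>/2)}"
  have C: "closed ?C"
    using pos by (intro closed_Collect_le continuous_intros) auto
  have W: "\<bar>z \<bullet> vector [- sin (\<alpha>/2), cos (\<alpha>/2)]\<bar> \<le> (z \<bullet> vector [cos (\<alpha>/2), sin (\<alpha>/2)]) / cos (\<alpha>/2)"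
    if z: "z \<in> wedge \<alpha>" for z
  proof -
    obtain r \<phi> where z: "z = vector [r * cos \<phi>, r * sin \<phi>]" "0 < r" "0 < \<phi>" "\<phi> < \<alpha>"
      using z by (auto simp: wedge_def)
    have 1: "z \<bullet> vector [- sin (\<alpha>/2), cos (\<alpha>/2)] = r * sin (\<phi> - \<alpha>/2)"
      by (simp add: z inner_vec_def sum_2 sin_diff algebra_simps)
    have 2: "z \<bullet> vector [cos (\<alpha>/2), sin (\<alpha>/2)] = r * cos (\<phi> - \<alpha>/2)"
      by (simp add: z inner_vec_def sum_2 cos_diff algebra_simps)
    have "cos (\<alpha>/2) \<le> cos \<bar>\<phi> - \<alpha>/2\<bar>" using z assms by (intro cos_monotone_0_pi_le) (auto simp: abs_if)
    then have "cos (\<alpha>/2) \<le> cos (\<phi> - \<alpha>/2)" by simp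
    then have "1 \<le> cos (\<phi> - \<alpha>/2) / cos (\<alpha>/2)" using pos by simp
    then have "r * 1 \<le> r * (cos (\<phi> - \<alpha>/2) / cos (\<alpha>/2))" using z by (intro mult_left_mono) auto
    moreover have "\<bar>r * sin (\<phi> - \<alpha>/2)\<bar> \<le> r * 1" 
      using z unfolding abs_mult by (intro mult_mono) auto
    ultimately show ?thesis unfolding 1 2 by simp
  qed
  have "closure (wedge \<alpha>) \<subseteq> ?C"
    by (rule closure_minimal[OF _ C]) (use W in blast)
  then show ?thesis using assms(3) by blast
qed

section \<open>Independence of past and next step\<close>

lemma measurable_vec_component[measurable (raw)]:
  fixes f :: "'a \<Rightarrow> real^'n"
  assumes "f \<in> borel_measurable M"
  shows "(\<lambda>\<omega>. f \<omega> $ i) \<in> borel_measurable M"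
  by (rule measurable_compose[OF assms]) (intro borel_measurable_continuous_onI continuous_intros)

locale standard_planar_walk = prob_space M for M :: "'a measure" +
  fixes X :: "'a \<Rightarrow> real^2" and Y :: "nat \<Rightarrow> 'a \<Rightarrow> real^2"
  assumes X_measurable[measurable]: "X \<in> borel_measurable M"
    and X_integrable: "\<And>i. integrable M (\<lambda>\<omega>. X \<omega> $ i)"
    and X_mean: "\<And>i. expectation (\<lambda>\<omega>. X \<omega> $ i) = 0"
    and XX_integrable: "\<And>i j. integrable M (\<lambda>\<omega>. X \<omega> $ i * X \<omega> $ j)"
    and XX_mean: "\<And>i j. expectation (\<lambda>\<omega>. X \<omega> $ i * X \<omega> $ j) = (if i = j then 1 else 0)"
    and Y_indep: "indep_vars (\<lambda>_. borel) Y {1..}"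
    and Y_distr: "\<And>n. 1 \<le> n \<Longrightarrow> distr M borel (Y n) = distr M borel X"
begin

lemma Y_measurable: "1 \<le> n \<Longrightarrow> Y n \<in> borel_measurable M"
  using Y_indep by (auto simp: indep_vars_def)

lemma Y_Suc_measurable[measurable]: "Y (Suc n) \<in> borel_measurable M"
  by (rule Y_measurable) simp

definition past :: "nat \<Rightarrow> 'a measure" where
  "past n = vimage_algebra (space M) (\<lambda>\<omega>. \<lambda>i\<in>{1..n}. Y i \<omega>) (PiM {1..n} (\<lambda>_. borel))"

lemma space_past[simp]: "space (past n) = space M"
  by (simp add: past_def)

lemma past_map_measurable: "(\<lambda>\<omega>. \<lambda>i\<in>{1..n}. Y i \<omega>) \<in> M \<rightarrow>\<^sub>M PiM {1..n} (\<lambda>_. borel)"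
  by (intro measurable_restrict Y_measurable) auto

lemma sets_past: "sets (past n) = {(\<lambda>\<omega>. \<lambda>i\<in>{1..n}. Y i \<omega>) -` A \<inter> space M | A. A \<in> sets (PiM {1..n} (\<lambda>_. borel))}"
  unfolding past_def by (rule sets_vimage_algebra2) (use measurable_space[OF past_map_measurable] in auto)

lemma subalgebra_past: "subalgebra M (past n)"
  unfolding subalgebra_def sets_past using measurable_sets[OF past_map_measurable] by auto

lemma measurable_from_past: "f \<in> past n \<rightarrow>\<^sub>M N \<Longrightarrow> f \<in> M \<rightarrow>\<^sub>M N"
  using measurable_from_subalg[OF subalgebra_past] .

lemma Y_past: 
  assumes "1 \<le> i" "i \<le> n"
  shows "Y i \<in> past n \<rightarrow>\<^sub>M borel"
proof -
  have "(\<lambda>\<omega>. \<lambda>i\<in>{1..n}. Y i \<omega>) \<in> past n \<rightarrow>\<^sub>M PiM {1..n} (\<lambda>_. borel)"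
    unfolding past_def by (rule measurable_vimage_algebra1) (use measurable_space[OF past_map_measurable] in auto)
  then have "(\<lambda>\<omega>. (\<lambda>i\<in>{1..n}. Y i \<omega>) i) \<in> past n \<rightarrow>\<^sub>M borel"
    by (rule measurable_compose[OF _ measurable_component_singleton]) (use assms in auto)
  then show ?thesis using assms by simp
qed

lemma past_mono:
  assumes "n \<le> m"
  shows "subalgebra (past m) (past n)"
proof -
  have "(\<lambda>\<omega>. \<lambda>i\<in>{1..n}. Y i \<omega>) \<in> past m \<rightarrow>\<^sub>M PiM {1..n} (\<lambda>_. borel)"
    using assms by (intro measurable_restrict Y_past) auto
  from measurable_sets[OF this] show ?thesis
    unfolding subalgebra_def by (auto simp: sets_past[of n])
qed

lemma measurable_past_mono: "f \<in> past n \<rightarrow>\<^sub>M N \<Longrightarrow> n \<le> m \<Longrightarrow> f \<in> past m \<rightarrow>\<^sub>M N"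
  using measurable_from_subalg[OF past_mono] .

text \<open>The two blocks of steps are independent as families; the claim follows on the level of generated
sigma-algebras, where \<open>f\<close> contributes a subalgebra of the past without having to be written as a function of the steps.\<close>
lemma indep_past_step:
  fixes f :: "'a \<Rightarrow> real" and h :: "real^2 \<Rightarrow> real"
  assumes f: "f \<in> past n \<rightarrow>\<^sub>M borel" and h: "h \<in> borel \<rightarrow>\<^sub>M borel"
  shows "indep_var borel f borel (\<lambda>\<omega>. h (Y (Suc n) \<omega>))"
proof -
  let ?P = "\<lambda>\<omega>. \<lambda>i\<in>{1..n}. Y i \<omega>" and ?Q = "\<lambda>\<omega>. \<lambda>i\<in>{Suc n}. Y i \<omega>"
  let ?PM = "PiM {1..n} (\<lambda>_. borel :: (real^2) measure)"
  let ?QM = "PiM {Suc n} (\<lambda>_. borel :: (real^2) measure)"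
  have "indep_var ?PM ?P ?QM ?Q"
    by (rule indep_var_restrict[OF Y_indep]) auto
  then have I: "indep_set (sigma_sets (space M) {?P -` A \<inter> space M | A. A \<in> sets ?PM})
      (sigma_sets (space M) {?Q -` A \<inter> space M | A. A \<in> sets ?QM})"
    unfolding indep_var_eq by blast
  have F: "sigma_sets (space M) {f -` A \<inter> space M | A. A \<in> sets borel}
      \<subseteq> sigma_sets (space M) {?P -` A \<inter> space M | A. A \<in> sets ?PM}"
  proof (rule sigma_sets_subseteq, safe)
    fix A :: "real set" assume "A \<in> sets borel"
    then have "f -` A \<inter> space M \<in> sets (past n)" using measurable_sets[OF f] by simp
    then show "\<exists>B. f -` A \<inter> space M = ?P -` B \<inter> space M \<and> B \<in> sets ?PM"
      unfolding sets_past by blast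
  qed
  have "sigma_sets (space M) {(\<lambda>\<omega>. h (Y (Suc n) \<omega>)) -` A \<inter> space M | A. A \<in> sets borel}
      \<subseteq> sigma_sets (space M) {?Q -` A \<inter> space M | A. A \<in> sets ?QM}"
  proof (rule sigma_sets_subseteq, safe)
    fix A :: "real set" assume A: "A \<in> sets borel"
    have g: "(\<lambda>q. h (q (Suc n))) \<in> ?QM \<rightarrow>\<^sub>M borel"
      by (auto intro!: measurable_compose[OF _ h])
    have "(\<lambda>\<omega>. h (Y (Suc n) \<omega>)) -` A \<inter> space M
        = ?Q -` ((\<lambda>q. h (q (Suc n))) -` A \<inter> space ?QM) \<inter> space M"
      by (auto simp: space_PiM)
    then show "\<exists>B. (\<lambda>\<omega>. h (Y (Suc n) \<omega>)) -` A \<inter> space M = ?Q -` B \<inter> space M \<and> B \<in> sets ?QM"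
      using measurable_sets[OF g A] by blast
  qed
  with F have "indep_set (sigma_sets (space M) {f -` A \<inter> space M | A. A \<in> sets borel})
      (sigma_sets (space M) {(\<lambda>\<omega>. h (Y (Suc n) \<omega>)) -` A \<inter> space M | A. A \<in> sets borel})"
    using I unfolding indep_set_def
    by (elim indep_sets_mono_sets) (auto split: bool.split)
  then show ?thesis
    unfolding indep_var_eq using measurable_from_past[OF f] h by (auto intro!: measurable_compose[OF _ h])
qed

lemma step_moment:
  fixes h :: "real^2 \<Rightarrow> real"
  assumes h[measurable]: "h \<in> borel_measurable borel" and i: "integrable M (\<lambda>\<omega>. h (X \<omega>))"
  shows "integrable M (\<lambda>\<omega>. h (Y (Suc n) \<omega>))" "expectation (\<lambda>\<omega>. h (Y (Suc n) \<omega>)) = expectation (\<lambda>\<omega>. h (X \<omega>))"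
proof -
  have "integrable (distr M borel X) h" using i by (simp add: integrable_distr_eq)
  then have "integrable (distr M borel (Y (Suc n))) h" by (simp add: Y_distr)
  then show "integrable M (\<lambda>\<omega>. h (Y (Suc n) \<omega>))" by (simp add: integrable_distr_eq)
  have "integral\<^sup>L (distr M borel (Y (Suc n))) h = integral\<^sup>L (distr M borel X) h" by (simp add: Y_distr)
  then show "expectation (\<lambda>\<omega>. h (Y (Suc n) \<omega>)) = expectation (\<lambda>\<omega>. h (X \<omega>))"
    by (simp add: integral_distr)
qed

text \<open>The source of all martingale identities below: conditioning on the past is only ever applied to sums of
products of a past factor and a function of the next step, where independence gives the mean directly.\<close>
lemma past_times_step:
  fixes f :: "'a \<Rightarrow> real" and h :: "real^2 \<Rightarrow> real"
  assumes f: "f \<in> past n \<rightarrow>\<^sub>M borel" "integrable M f"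
    and h: "h \<in> borel_measurable borel" "integrable M (\<lambda>\<omega>. h (X \<omega>))"
  shows "integrable M (\<lambda>\<omega>. f \<omega> * h (Y (Suc n) \<omega>))"
    and "expectation (\<lambda>\<omega>. f \<omega> * h (Y (Suc n) \<omega>)) = expectation f * expectation (\<lambda>\<omega>. h (X \<omega>))"
  using indep_var_integrable[OF indep_past_step[OF f(1) h(1)] f(2) step_moment(1)[OF h]]
    indep_var_lebesgue_integral[OF indep_past_step[OF f(1) h(1)] f(2) step_moment(1)[OF h]]
    step_moment(2)[OF h] by auto

lemma X_inner:
  shows X_inner_integrable: "integrable M (\<lambda>\<omega>. X \<omega> \<bullet> a)"
    and X_inner_mean: "expectation (\<lambda>\<omega>. X \<omega> \<bullet> a) = 0"
    and X_inner2_integrable: "integrable M (\<lambda>\<omega>. (X \<omega> \<bullet> a) * (X \<omega> \<bullet> b))"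
    and X_inner2_mean: "expectation (\<lambda>\<omega>. (X \<omega> \<bullet> a) * (X \<omega> \<bullet> b)) = a \<bullet> b"
proof -
  have 1: "X \<omega> \<bullet> a = X \<omega> $ 1 * a $ 1 + X \<omega> $ 2 * a $ 2" for \<omega> a
    by (simp add: inner_vec_def sum_2)
  show "integrable M (\<lambda>\<omega>. X \<omega> \<bullet> a)" "expectation (\<lambda>\<omega>. X \<omega> \<bullet> a) = 0"
    by (simp_all add: 1 X_integrable X_mean)
  have 2: "(X \<omega> \<bullet> a) * (X \<omega> \<bullet> b) = a $ 1 * b $ 1 * (X \<omega> $ 1 * X \<omega> $ 1) + a $ 1 * b $ 2 * (X \<omega> $ 1 * X \<omega> $ 2)
      + a $ 2 * b $ 1 * (X \<omega> $ 1 * X \<omega> $ 2) + a $ 2 * b $ 2 * (X \<omega> $ 2 * X \<omega> $ 2)" for \<omega>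
    by (simp add: 1 algebra_simps)
  show "integrable M (\<lambda>\<omega>. (X \<omega> \<bullet> a) * (X \<omega> \<bullet> b))"
    unfolding 2 by (intro Bochner_Integration.integrable_add integrable_mult_right XX_integrable)
  show "expectation (\<lambda>\<omega>. (X \<omega> \<bullet> a) * (X \<omega> \<bullet> b)) = a \<bullet> b"
    unfolding 2 by (simp add: XX_integrable XX_mean inner_vec_def sum_2)
qed

end


section \<open>Moments of the stopped walk\<close>

text \<open>Freezing the walk at the first point outside \<open>K\<close>, by recursion instead of through the exit time, makes
measurability with respect to the past immediate and works for paths that never leave \<open>K\<close>.\<close>
primrec stopped :: "(real^2) set \<Rightarrow> (nat \<Rightarrow> 'a \<Rightarrow> real^2) \<Rightarrow> real^2 \<Rightarrow> nat \<Rightarrow> 'a \<Rightarrow> real^2" where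
  "stopped K Y x 0 \<omega> = x"
| "stopped K Y x (Suc n) \<omega> =
     stopped K Y x n \<omega> + (if stopped K Y x n \<omega> \<in> K then Y (Suc n) \<omega> else 0)"

locale stopped_planar_walk = standard_planar_walk +
  fixes K :: "(real^2) set" and x :: "real^2"
  assumes K_borel[measurable]: "K \<in> sets borel"
begin

abbreviation Z :: "nat \<Rightarrow> 'a \<Rightarrow> real^2" where "Z \<equiv> stopped K Y x"

definition running :: "nat \<Rightarrow> 'a \<Rightarrow> real" where
  "running n \<omega> = indicator K (Z n \<omega>)"

text \<open>The expected number of steps made before time \<open>n\<close>; from a start in \<open>K\<close> it is the
mean of the exit time capped at \<open>n\<close>.\<close>
definition clock :: "nat \<Rightarrow> real" where
  "clock n = (\<Sum>k<n. expectation (running k))"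

lemma Z_Suc: "Z (Suc n) \<omega> $ i = Z n \<omega> $ i + running n \<omega> * Y (Suc n) \<omega> $ i"
  by (simp add: running_def)

lemma running_bounds: "0 \<le> running n \<omega>" "running n \<omega> \<le> 1" "running n \<omega> * running n \<omega> = running n \<omega>"
  by (simp_all add: running_def indicator_def)

lemma Z_past: "Z n \<in> past n \<rightarrow>\<^sub>M borel"
proof (induction n)
  case 0
  show ?case by (simp add: measurable_cong[of _ "Z 0" "\<lambda>_. x"])
next
  case (Suc n)
  have [measurable]: "Z n \<in> past (Suc n) \<rightarrow>\<^sub>M borel" by (rule measurable_past_mono[OF Suc]) simp
  have [measurable]: "Y (Suc n) \<in> past (Suc n) \<rightarrow>\<^sub>M borel" by (rule Y_past) auto
  have "(\<lambda>\<omega>. Z n \<omega> + (if Z n \<omega> \<in> K then Y (Suc n) \<omega> else 0)) \<in> past (Suc n) \<rightarrow>\<^sub>M borel"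
    by measurable
  then show ?case by (simp cong: measurable_cong)
qed

lemma Z_measurable[measurable]: "Z n \<in> borel_measurable M"
  by (rule measurable_from_past[OF Z_past])

lemma running_past: "running n \<in> past n \<rightarrow>\<^sub>M borel"
proof -
  note [measurable] = Z_past[of n]
  show ?thesis unfolding running_def by measurable
qed

lemma running_integrable: "integrable M (running n)"
  by (rule integrable_const_bound[of _ 1])
    (auto simp: running_bounds measurable_from_past[OF running_past])

text \<open>The cross terms vanish because the new step is centred and independent of the increment so far. Each
executed step adds the identity matrix to the covariance, weighted by the probability that it is executed.\<close>
lemma increment_moments:
  assumes "n \<le> m"
  shows "integrable M (\<lambda>\<omega>. (Z m \<omega> - Z n \<omega>) $ i)
    \<and> expectation (\<lambda>\<omega>. (Z m \<omega> - Z n \<omega>) $ i) = 0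
    \<and> integrable M (\<lambda>\<omega>. (Z m \<omega> - Z n \<omega>) $ i * (Z m \<omega> - Z n \<omega>) $ j)
    \<and> expectation (\<lambda>\<omega>. (Z m \<omega> - Z n \<omega>) $ i * (Z m \<omega> - Z n \<omega>) $ j)
        = (if i = j then clock m - clock n else 0)"
  using assms
proof (induction m arbitrary: i j rule: dec_induct)
  case base
  then show ?case by simp
next
  case (step m)
  define D where "D i \<omega> = (Z m \<omega> - Z n \<omega>) $ i" for i \<omega>
  have IH: "integrable M (D i)" "expectation (D i) = 0" "integrable M (\<lambda>\<omega>. D i \<omega> * D j \<omega>)"
    "expectation (\<lambda>\<omega>. D i \<omega> * D j \<omega>) = (if i = j then clock m - clock n else 0)" for i j
    using step.IH[of i j] unfolding D_def by auto
  note [measurable] = Z_past[of m] measurable_past_mono[OF Z_past[of n] step.hyps(1)] running_past[of m]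
  have [measurable]: "D i \<in> past m \<rightarrow>\<^sub>M borel" for i unfolding D_def by measurable
  have iDr: "integrable M (\<lambda>\<omega>. D i \<omega> * running m \<omega>)" for i
  proof (rule Bochner_Integration.integrable_bound[OF IH(1)[of i]])
    show "(\<lambda>\<omega>. D i \<omega> * running m \<omega>) \<in> borel_measurable M" by (rule measurable_from_past[of _ m]) measurable
    show "AE \<omega> in M. norm (D i \<omega> * running m \<omega>) \<le> norm (D i \<omega>)"
      using running_bounds by (simp add: abs_mult mult_left_le)
  qed
  have pY: "integrable M (\<lambda>\<omega>. running m \<omega> * Y (Suc m) \<omega> $ i)"
    "expectation (\<lambda>\<omega>. running m \<omega> * Y (Suc m) \<omega> $ i) = 0" for i
    using past_times_step[of "running m" m "\<lambda>v. v $ i"] running_past running_integrable X_integrable X_mean by auto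
  have pDY: "integrable M (\<lambda>\<omega>. (D i \<omega> * running m \<omega>) * Y (Suc m) \<omega> $ j)"
    "expectation (\<lambda>\<omega>. (D i \<omega> * running m \<omega>) * Y (Suc m) \<omega> $ j) = 0" for i j
    using past_times_step[of "\<lambda>\<omega>. D i \<omega> * running m \<omega>" m "\<lambda>v. v $ j"] iDr X_integrable X_mean by auto
  have pYY: "integrable M (\<lambda>\<omega>. running m \<omega> * (Y (Suc m) \<omega> $ i * Y (Suc m) \<omega> $ j))"
    "expectation (\<lambda>\<omega>. running m \<omega> * (Y (Suc m) \<omega> $ i * Y (Suc m) \<omega> $ j)) = expectation (running m) * (if i = j then 1 else 0)" for i j
    using past_times_step[of "running m" m "\<lambda>v. v $ i * v $ j"] running_past running_integrable XX_integrable XX_mean by auto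
  have S: "(Z (Suc m) \<omega> - Z n \<omega>) $ i = D i \<omega> + running m \<omega> * Y (Suc m) \<omega> $ i" for i \<omega>
    unfolding vector_minus_component Z_Suc D_def by simp
  have SS: "(Z (Suc m) \<omega> - Z n \<omega>) $ i * (Z (Suc m) \<omega> - Z n \<omega>) $ j
     = D i \<omega> * D j \<omega> + (D i \<omega> * running m \<omega>) * Y (Suc m) \<omega> $ j + (D j \<omega> * running m \<omega>) * Y (Suc m) \<omega> $ i
       + running m \<omega> * (Y (Suc m) \<omega> $ i * Y (Suc m) \<omega> $ j)" for i j \<omega>
  proof -
    have "(d + r * u) * (e + r * v) = d * e + (d * r) * v + (e * r) * u + (r * r) * (u * v)" for d e r u v :: real
      by (simp add: algebra_simps)
    then show ?thesis unfolding S by (simp only: running_bounds(3))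
  qed
  show ?case unfolding SS unfolding S
    by (simp add: IH pY pDY pYY clock_def)
qed

lemma Z_moments:
  shows Z_integrable: "integrable M (\<lambda>\<omega>. Z n \<omega> $ i)"
    and Z_mean: "expectation (\<lambda>\<omega>. Z n \<omega> $ i) = x $ i"
    and ZZ_integrable: "integrable M (\<lambda>\<omega>. Z n \<omega> $ i * Z n \<omega> $ j)"
    and ZZ_mean: "expectation (\<lambda>\<omega>. Z n \<omega> $ i * Z n \<omega> $ j) = x $ i * x $ j + (if i = j then clock n else 0)"
proof -
  define D where "D i \<omega> = (Z n \<omega> - Z 0 \<omega>) $ i" for i \<omega>
  have D: "integrable M (D i)" "expectation (D i) = 0" "integrable M (\<lambda>\<omega>. D i \<omega> * D j \<omega>)"
    "expectation (\<lambda>\<omega>. D i \<omega> * D j \<omega>) = (if i = j then clock n else 0)" for i j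
    using increment_moments[of 0 n i j] unfolding D_def by (auto simp: clock_def)
  have 1: "Z n \<omega> $ i = x $ i + D i \<omega>" for \<omega> i by (simp add: D_def)
  have 2: "(x $ i + D i \<omega>) * (x $ j + D j \<omega>) = x $ i * x $ j + x $ i * D j \<omega> + x $ j * D i \<omega> + D i \<omega> * D j \<omega>" for \<omega> i j
    by (simp add: algebra_simps)
  show "integrable M (\<lambda>\<omega>. Z n \<omega> $ i)" "expectation (\<lambda>\<omega>. Z n \<omega> $ i) = x $ i"
    unfolding 1 by (simp_all add: D prob_space)
  show "integrable M (\<lambda>\<omega>. Z n \<omega> $ i * Z n \<omega> $ j)"
    "expectation (\<lambda>\<omega>. Z n \<omega> $ i * Z n \<omega> $ j) = x $ i * x $ j + (if i = j then clock n else 0)"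
    unfolding 1 2 by (simp_all add: D prob_space)
qed

lemma clock_incseq: "incseq clock"
  by (rule incseq_SucI) (simp add: clock_def running_bounds)

text \<open>A bounded clock converges, hence its increments from some time \<open>N\<close> on are small, and these control the mean
square distances of the later \<open>Z n\<close> from \<open>Z N\<close>. So \<open>2 \<bar>Z N\<bar>\<^sup>2\<close> dominates the products of
coordinates of \<open>Z n\<close> up to an error of small mean.\<close>
lemma second_moments_of_limit:
  assumes B[measurable]: "B \<in> borel_measurable M"
    and lim: "AE \<omega> in M. (\<lambda>n. Z n \<omega>) \<longlonglongrightarrow> B \<omega>"
    and bounded: "\<And>n. clock n \<le> c"
  shows "\<exists>L. \<forall>i j. integrable M (\<lambda>\<omega>. B \<omega> $ i * B \<omega> $ j) \<and>
     expectation (\<lambda>\<omega>. B \<omega> $ i * B \<omega> $ j) = x $ i * x $ j + (if i = j then L else 0)"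
proof -
  obtain L where L: "clock \<longlonglongrightarrow> L" "\<And>n. clock n \<le> L"
    using incseq_convergent[OF clock_incseq] bounded by blast
  have "integrable M (\<lambda>\<omega>. B \<omega> $ i * B \<omega> $ j) \<and>
     expectation (\<lambda>\<omega>. B \<omega> $ i * B \<omega> $ j) = x $ i * x $ j + (if i = j then L else 0)" for i j
  proof -
    have A: "integrable M (\<lambda>\<omega>. B \<omega> $ i * B \<omega> $ j) \<and>
      (\<lambda>n. expectation (\<lambda>\<omega>. Z n \<omega> $ i * Z n \<omega> $ j)) \<longlonglongrightarrow> expectation (\<lambda>\<omega>. B \<omega> $ i * B \<omega> $ j)"
    proof (rule expectation_tendsto_of_uniformly_integrable)
      show "integrable M (\<lambda>\<omega>. Z n \<omega> $ i * Z n \<omega> $ j)" for n by (rule ZZ_integrable)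
      show "(\<lambda>\<omega>. B \<omega> $ i * B \<omega> $ j) \<in> borel_measurable M" by measurable
      show "AE \<omega> in M. (\<lambda>n. Z n \<omega> $ i * Z n \<omega> $ j) \<longlonglongrightarrow> B \<omega> $ i * B \<omega> $ j"
        using lim by eventually_elim (intro tendsto_intros)
      fix \<epsilon> :: real assume \<epsilon>: "0 < \<epsilon>"
      obtain N where N: "L - clock N \<le> \<epsilon> / 4"
      proof -
        have "\<forall>\<^sub>F n in sequentially. dist (clock n) L < \<epsilon> / 4" using \<epsilon> by (intro tendstoD[OF L(1)]) simp
        then obtain N where "dist (clock N) L < \<epsilon> / 4" by (auto simp: eventually_sequentially)
        then show ?thesis using that[of N] L(2)[of N] by (simp add: dist_real_def)
      qed
      define G where "G \<omega> = 2 * (Z N \<omega> $ 1 * Z N \<omega> $ 1 + Z N \<omega> $ 2 * Z N \<omega> $ 2)" for \<omega>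
      define \<Phi> where "\<Phi> n \<omega> = 2 * ((Z n \<omega> - Z N \<omega>) $ 1 * (Z n \<omega> - Z N \<omega>) $ 1 + (Z n \<omega> - Z N \<omega>) $ 2 * (Z n \<omega> - Z N \<omega>) $ 2)" for n \<omega>
      have le: "\<bar>Z n \<omega> $ i * Z n \<omega> $ j\<bar> \<le> G \<omega> + \<Phi> n \<omega>" for n \<omega>
      proof -
        define p q where "p = Z N \<omega>" and "q = Z n \<omega> - Z N \<omega>"
        have Zn: "Z n \<omega> = p + q" by (simp add: p_def q_def)
        have "\<bar>Z n \<omega> $ i * Z n \<omega> $ j\<bar> \<le> norm (Z n \<omega>) * norm (Z n \<omega>)"
          unfolding abs_mult by (intro mult_mono component_le_norm_cart) auto
        also have "\<dots> = (norm (p + q))\<^sup>2" by (simp add: Zn power2_eq_square)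
        also have "\<dots> \<le> 2 * (norm p)\<^sup>2 + 2 * (norm q)\<^sup>2"
        proof -
          have "(norm (p + q))\<^sup>2 \<le> (norm p + norm q)\<^sup>2" by (intro power_mono norm_triangle_ineq) auto
          also have "\<dots> \<le> 2 * (norm p)\<^sup>2 + 2 * (norm q)\<^sup>2"
            using sum_squares_bound[of "norm p" "norm q"] by (simp add: power2_sum)
          finally show ?thesis .
        qed
        also have "\<dots> = G \<omega> + \<Phi> n \<omega>"
          unfolding G_def \<Phi>_def p_def q_def
          by (simp add: power2_norm_eq_inner inner_vec_def sum_2)
        finally show ?thesis .
      qed
      have \<Phi>: "integrable M (\<Phi> n)" "expectation (\<Phi> n) \<le> \<epsilon>" "\<And>\<omega>. 0 \<le> \<Phi> n \<omega>" if "N \<le> n" for n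
      proof -
        note I = increment_moments[OF that]
        show "integrable M (\<Phi> n)" unfolding \<Phi>_def using I by (intro integrable_mult_right Bochner_Integration.integrable_add) auto
        have "expectation (\<Phi> n) = 2 * ((clock n - clock N) + (clock n - clock N))" unfolding \<Phi>_def
          using I by (subst integral_mult_right_zero, subst Bochner_Integration.integral_add) auto
        then show "expectation (\<Phi> n) \<le> \<epsilon>" using N L(2)[of n] by simp
        show "\<And>\<omega>. 0 \<le> \<Phi> n \<omega>" by (simp add: \<Phi>_def)
      qed
      show "\<exists>G. integrable M G \<and> (\<forall>\<omega>. 0 \<le> G \<omega>) \<and>
       (\<forall>\<^sub>F n in sequentially. \<exists>\<Phi>. integrable M \<Phi> \<and> expectation \<Phi> \<le> \<epsilon> \<and>
          (AE \<omega> in M. 0 \<le> \<Phi> \<omega> \<and> \<bar>Z n \<omega> $ i * Z n \<omega> $ j\<bar> \<le> G \<omega> + \<Phi> \<omega>))"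
      proof (intro exI[of _ G] conjI allI)
        show "integrable M G" unfolding G_def by (intro integrable_mult_right Bochner_Integration.integrable_add ZZ_integrable)
        show "0 \<le> G \<omega>" for \<omega> by (simp add: G_def)
        show "\<forall>\<^sub>F n in sequentially. \<exists>\<Phi>. integrable M \<Phi> \<and> expectation \<Phi> \<le> \<epsilon> \<and>
          (AE \<omega> in M. 0 \<le> \<Phi> \<omega> \<and> \<bar>Z n \<omega> $ i * Z n \<omega> $ j\<bar> \<le> G \<omega> + \<Phi> \<omega>)"
          using eventually_ge_at_top[of N]
        proof eventually_elim
          case (elim n)
          then show ?case using \<Phi>[OF elim] le by (intro exI[of _ "\<Phi> n"]) auto
        qed
      qed
    qed
    have "(\<lambda>n. x $ i * x $ j + (if i = j then clock n else 0)) \<longlonglongrightarrow> x $ i * x $ j + (if i = j then L else 0)"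
      using L(1) by (auto intro!: tendsto_intros)
    then show ?thesis using A unfolding ZZ_mean using LIMSEQ_unique by blast
  qed
  then show ?thesis by blast
qed

end

section \<open>Uniform integrability in a cone\<close>

locale walk_in_cone = stopped_planar_walk M X Y K x
  for M :: "'a measure" and X Y K x +
  fixes \<beta> T :: real
  assumes T: "0 < T"
    and cone: "AE \<omega> in M. \<forall>n. \<bar>Z n \<omega> \<bullet> vector [- sin \<beta>, cos \<beta>]\<bar> \<le> T * (Z n \<omega> \<bullet> vector [cos \<beta>, sin \<beta>])"
begin

text \<open>\<open>axis\<close> and \<open>normal\<close> are an orthonormal frame in which the cone condition reads
\<open>\<bar>w\<bar> \<le> T * y\<close> for the coordinates \<open>w\<close> along \<open>normal\<close> and \<open>y\<close> along \<open>axis\<close>.\<close>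
definition axis :: "real^2" where "axis = vector [cos \<beta>, sin \<beta>]"

definition normal :: "real^2" where "normal = vector [- sin \<beta>, cos \<beta>]"

lemma orthonormal: "axis \<bullet> axis = 1" "normal \<bullet> normal = 1" "axis \<bullet> normal = 0"
  by (simp_all add: axis_def normal_def inner_vec_def sum_2 flip: power2_eq_square)

lemma inner_axis: "v \<bullet> axis = v $ 1 * cos \<beta> + v $ 2 * sin \<beta>"
  by (simp add: axis_def inner_vec_def sum_2)

lemma norm_le_frame: "norm z \<le> \<bar>z \<bullet> axis\<bar> + \<bar>z \<bullet> normal\<bar>"
proof -
  have "norm axis = 1" "norm normal = 1" by (simp_all add: norm_eq_1 orthonormal)
  moreover have "z = (z \<bullet> axis) *\<^sub>R axis + (z \<bullet> normal) *\<^sub>R normal"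
  proof -
    have "cos \<beta> * (cos \<beta> * t) + sin \<beta> * (sin \<beta> * t) = ((cos \<beta>)\<^sup>2 + (sin \<beta>)\<^sup>2) * t" for t
      by (simp only: distrib_right mult.assoc power2_eq_square)
    then have cs: "cos \<beta> * (cos \<beta> * t) + sin \<beta> * (sin \<beta> * t) = t" for t by simp
    show ?thesis
      by (simp add: vec_eq_iff forall_2 axis_def normal_def inner_vec_def sum_2 algebra_simps cs)
  qed
  ultimately show ?thesis
    by (metis norm_triangle_ineq norm_scaleR mult.right_neutral)
qed

text \<open>The part of the squared step length that comes from steps with a large axial component; truncation in
the axial direction is all that \<open>drift_inequality\<close> asks for.\<close>
definition tail :: "real \<Rightarrow> real^2 \<Rightarrow> real" where
  "tail b v = (if b < \<bar>v \<bullet> axis\<bar> then (v \<bullet> axis)\<^sup>2 + (v \<bullet> normal)\<^sup>2 else 0)"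

lemma tail_measurable[measurable]: "tail b \<in> borel_measurable borel"
  unfolding tail_def by measurable

lemma squares_integrable: "integrable M (\<lambda>\<omega>. (X \<omega> \<bullet> axis)\<^sup>2 + (X \<omega> \<bullet> normal)\<^sup>2)"
  unfolding power2_eq_square by (intro Bochner_Integration.integrable_add X_inner2_integrable)

lemma tail_integrable: "integrable M (\<lambda>\<omega>. tail b (X \<omega>))"
  by (rule Bochner_Integration.integrable_bound[OF squares_integrable]) (auto simp: tail_def)

text \<open>This fixes the shift \<open>b\<close>: the tail of the second moment has to be small against the factor \<open>1 + T\<^sup>2\<close>
by which the slope of a point of the cone can magnify it.\<close>
lemma tail_small: "\<exists>b\<ge>1. (1 + T\<^sup>2) * expectation (\<lambda>\<omega>. tail b (X \<omega>)) \<le> 1 / 2"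
proof -
  have "(\<lambda>k. expectation (\<lambda>\<omega>. tail (real k) (X \<omega>))) \<longlonglongrightarrow> expectation (\<lambda>\<omega>. 0)"
  proof (rule integral_dominated_convergence[OF _ _ squares_integrable])
    show "AE \<omega> in M. (\<lambda>k. tail (real k) (X \<omega>)) \<longlonglongrightarrow> 0"
    proof (rule AE_I2, rule tendsto_eventually)
      fix \<omega>
      obtain k where "\<bar>X \<omega> \<bullet> axis\<bar> \<le> real k" using real_arch_simple by blast
      then show "\<forall>\<^sub>F k in sequentially. tail (real k) (X \<omega>) = 0"
        unfolding tail_def by (intro eventually_sequentiallyI[of k]) auto
    qed
  qed (auto simp: tail_def)
  then have "\<forall>\<^sub>F k in sequentially. dist (expectation (\<lambda>\<omega>. tail (real k) (X \<omega>))) 0 < 1 / (2 * (1 + T\<^sup>2))"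
    using T by (intro tendstoD) (auto simp: add_pos_nonneg)
  with eventually_ge_at_top[of 1]
  have "\<forall>\<^sub>F k in sequentially. 1 \<le> k \<and> dist (expectation (\<lambda>\<omega>. tail (real k) (X \<omega>))) 0 < 1 / (2 * (1 + T\<^sup>2))"
    by eventually_elim auto
  then obtain k :: nat where k: "1 \<le> k" "dist (expectation (\<lambda>\<omega>. tail (real k) (X \<omega>))) 0 < 1 / (2 * (1 + T\<^sup>2))"
    using eventually_happens'[OF sequentially_bot] by blast
  have "expectation (\<lambda>\<omega>. tail (real k) (X \<omega>)) \<le> 1 / (2 * (1 + T\<^sup>2))"
    using k(2) by (simp add: dist_real_def)
  then have "(1 + T\<^sup>2) * expectation (\<lambda>\<omega>. tail (real k) (X \<omega>)) \<le> (1 + T\<^sup>2) * (1 / (2 * (1 + T\<^sup>2)))"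
    by (intro mult_left_mono) auto
  also have "\<dots> = 1 / 2" using add_pos_nonneg[of 1 "T\<^sup>2"] by (simp add: field_simps)
  finally show ?thesis using k(1) by (intro exI[of _ "real k"]) auto
qed

text \<open>The shift \<open>b\<close> keeps \<open>height\<close> at least \<open>b\<close> on the closed cone, including its apex, so the
logarithm and the quotients below are harmless and the expansion error is small everywhere.\<close>
definition height :: "real \<Rightarrow> nat \<Rightarrow> 'a \<Rightarrow> real" where
  "height b n \<omega> = Z n \<omega> \<bullet> axis + b"

definition offset :: "nat \<Rightarrow> 'a \<Rightarrow> real" where
  "offset n \<omega> = Z n \<omega> \<bullet> normal"

definition slope :: "real \<Rightarrow> nat \<Rightarrow> 'a \<Rightarrow> real" where
  "slope b n \<omega> = offset n \<omega> / height b n \<omega>"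

definition lyapunov :: "real \<Rightarrow> nat \<Rightarrow> 'a \<Rightarrow> real" where
  "lyapunov b n \<omega> = height b n \<omega> * ln (height b n \<omega>) / 4 - (offset n \<omega>)\<^sup>2 / height b n \<omega>"

lemma past_coordinates:
  "height b n \<in> past n \<rightarrow>\<^sub>M borel" "offset n \<in> past n \<rightarrow>\<^sub>M borel" "slope b n \<in> past n \<rightarrow>\<^sub>M borel"
proof -
  note [measurable] = Z_past[of n]
  show [measurable]: "height b n \<in> past n \<rightarrow>\<^sub>M borel" unfolding height_def by measurable
  show [measurable]: "offset n \<in> past n \<rightarrow>\<^sub>M borel" unfolding offset_def by measurable
  show "slope b n \<in> past n \<rightarrow>\<^sub>M borel" unfolding slope_def by measurable
qed

lemmas coordinates_measurable[measurable] = past_coordinates[THEN measurable_from_past]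

lemma coordinate_bounds:
  assumes b: "1 \<le> b"
  shows "AE \<omega> in M. \<forall>n. b \<le> height b n \<omega> \<and> 1 \<le> height b n \<omega> \<and> \<bar>offset n \<omega>\<bar> \<le> T * height b n \<omega>
    \<and> \<bar>slope b n \<omega>\<bar> \<le> T \<and> (slope b n \<omega>)\<^sup>2 \<le> T\<^sup>2"
  using cone unfolding axis_def[symmetric] normal_def[symmetric]
proof (eventually_elim, intro allI)
  fix \<omega> n assume "\<forall>n. \<bar>Z n \<omega> \<bullet> normal\<bar> \<le> T * (Z n \<omega> \<bullet> axis)"
  then have c: "\<bar>Z n \<omega> \<bullet> normal\<bar> \<le> T * (Z n \<omega> \<bullet> axis)" by blast
  then have "0 \<le> T * (Z n \<omega> \<bullet> axis)" by linarith
  then have "0 \<le> Z n \<omega> \<bullet> axis" using T by (simp add: zero_le_mult_iff)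
  then have 1: "b \<le> height b n \<omega>" by (simp add: height_def)
  have "T * (Z n \<omega> \<bullet> axis) \<le> T * height b n \<omega>" using T b by (intro mult_left_mono) (auto simp: height_def)
  then have 2: "\<bar>offset n \<omega>\<bar> \<le> T * height b n \<omega>" using c by (simp add: offset_def)
  then have 3: "\<bar>slope b n \<omega>\<bar> \<le> T" using 1 b by (simp add: slope_def divide_le_eq)
  then have "\<bar>slope b n \<omega>\<bar>\<^sup>2 \<le> T\<^sup>2" by (intro power_mono) auto
  then show "b \<le> height b n \<omega> \<and> 1 \<le> height b n \<omega> \<and> \<bar>offset n \<omega>\<bar> \<le> T * height b n \<omega>
    \<and> \<bar>slope b n \<omega>\<bar> \<le> T \<and> (slope b n \<omega>)\<^sup>2 \<le> T\<^sup>2" using 1 2 3 b by simp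
qed

lemma height_integrable: "integrable M (height b n)"
  unfolding height_def inner_axis by (simp add: Z_integrable)

lemma height_mean: "expectation (height b n) = x \<bullet> axis + b"
  unfolding height_def inner_axis by (simp add: Z_integrable Z_mean prob_space)

lemma height_square_integrable: "integrable M (\<lambda>\<omega>. height b n \<omega> * height b n \<omega>)"
proof -
  have "height b n \<omega> * height b n \<omega> = cos \<beta> * cos \<beta> * (Z n \<omega> $ 1 * Z n \<omega> $ 1) + 2 * cos \<beta> * sin \<beta> * (Z n \<omega> $ 1 * Z n \<omega> $ 2)
      + sin \<beta> * sin \<beta> * (Z n \<omega> $ 2 * Z n \<omega> $ 2) + 2 * b * cos \<beta> * Z n \<omega> $ 1 + 2 * b * sin \<beta> * Z n \<omega> $ 2 + b * b" for \<omega>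
    by (simp add: height_def inner_axis algebra_simps)
  then show ?thesis by (simp add: ZZ_integrable Z_integrable)
qed

context
  fixes b :: real
  assumes b: "1 \<le> b"
begin

lemma height_log_integrable: "integrable M (\<lambda>\<omega>. height b n \<omega> * ln (height b n \<omega>))"
proof (rule Bochner_Integration.integrable_bound[OF height_square_integrable])
  show "AE \<omega> in M. norm (height b n \<omega> * ln (height b n \<omega>)) \<le> norm (height b n \<omega> * height b n \<omega>)"
    using coordinate_bounds[OF b]
  proof eventually_elim
    case (elim \<omega>)
    then have "1 \<le> height b n \<omega>" by blast
    moreover from this have "0 \<le> ln (height b n \<omega>)" "ln (height b n \<omega>) \<le> height b n \<omega> - 1"
      by (auto intro: ln_le_minus_one)
    ultimately show ?case by (simp add: abs_mult)
  qed
qed measurable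

lemma height_log_nonneg: "AE \<omega> in M. 0 \<le> height b n \<omega> * ln (height b n \<omega>)"
  using coordinate_bounds[OF b]
proof eventually_elim
  case (elim \<omega>)
  then have "1 \<le> height b n \<omega>" by blast
  then show ?case by simp
qed

lemma offset_ratio_bound:
  "AE \<omega> in M. 0 \<le> (offset n \<omega>)\<^sup>2 / height b n \<omega> \<and> (offset n \<omega>)\<^sup>2 / height b n \<omega> \<le> T\<^sup>2 * height b n \<omega>"
  using coordinate_bounds[OF b]
proof eventually_elim
  case (elim \<omega>)
  then have y: "1 \<le> height b n \<omega>" and "\<bar>offset n \<omega>\<bar> \<le> T * height b n \<omega>" by blast+
  from this(2) have "\<bar>offset n \<omega>\<bar>\<^sup>2 \<le> (T * height b n \<omega>)\<^sup>2" by (intro power_mono) auto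
  then show ?case using y by (simp add: divide_le_eq power2_eq_square mult_ac)
qed

lemma offset_ratio_integrable: "integrable M (\<lambda>\<omega>. (offset n \<omega>)\<^sup>2 / height b n \<omega>)"
proof (rule Bochner_Integration.integrable_bound[OF integrable_mult_right[OF height_integrable, of "T\<^sup>2"]])
  show "AE \<omega> in M. norm ((offset n \<omega>)\<^sup>2 / height b n \<omega>) \<le> norm (T\<^sup>2 * height b n \<omega>)"
    using offset_ratio_bound[of n] by eventually_elim (simp only: real_norm_def, linarith)
qed measurable

lemma lyapunov_integrable: "integrable M (lyapunov b n)"
  unfolding lyapunov_def
  by (intro Bochner_Integration.integrable_diff integrable_divide_zero height_log_integrable offset_ratio_integrable)

text \<open>The bound allows the height itself, which is what the logarithmic coefficient in \<open>lyapunov_step\<close> needs.\<close>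
lemma running_times_bounded_integrable:
  assumes f: "f \<in> past n \<rightarrow>\<^sub>M borel"
    and bound: "\<And>\<omega>. 1 \<le> height b n \<omega> \<Longrightarrow> \<bar>slope b n \<omega>\<bar> \<le> T \<Longrightarrow> (slope b n \<omega>)\<^sup>2 \<le> T\<^sup>2 \<Longrightarrow> \<bar>f \<omega>\<bar> \<le> c + height b n \<omega>"
  shows "integrable M (\<lambda>\<omega>. running n \<omega> * f \<omega>)"
proof (rule Bochner_Integration.integrable_bound)
  show "integrable M (\<lambda>\<omega>. c + height b n \<omega>)" by (simp add: height_integrable)
  show "AE \<omega> in M. norm (running n \<omega> * f \<omega>) \<le> norm (c + height b n \<omega>)"
    using coordinate_bounds[OF b]
  proof eventually_elim
    case (elim \<omega>)
    then have "\<bar>f \<omega>\<bar> \<le> c + height b n \<omega>" by (intro bound) blast+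
    moreover have "\<bar>running n \<omega> * f \<omega>\<bar> \<le> 1 * \<bar>f \<omega>\<bar>"
      unfolding abs_mult using running_bounds[of n \<omega>] by (intro mult_right_mono) auto
    ultimately show ?case by simp
  qed
  note [measurable] = f running_past[of n]
  show "(\<lambda>\<omega>. running n \<omega> * f \<omega>) \<in> borel_measurable M"
    by (rule measurable_from_past[of _ n]) measurable
qed

text \<open>On the event that the walk is still running, \<open>drift_inequality\<close> bounds the increment by a sum of past
coefficients times functions of the next step. In the mean, with slope \<open>m\<close> and
height \<open>y\<close>, the linear and mixed terms vanish and the rest adds up to at most
\<open>(1/4 - m\<^sup>2/2 - 1/2 + 1/4) / y \<le> 0\<close>, where the final \<open>1/4\<close> is the contribution of the tail.\<close>
lemma lyapunov_step:
  assumes tail: "(1 + T\<^sup>2) * expectation (\<lambda>\<omega>. tail b (X \<omega>)) \<le> 1 / 2"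
  shows "expectation (lyapunov b (Suc n)) \<le> expectation (lyapunov b n)"
proof -
  define \<delta> where "\<delta> = expectation (\<lambda>\<omega>. tail b (X \<omega>))"
  let ?r = "running n" and ?y = "height b n" and ?w = "offset n" and ?m = "slope b n" and ?Y = "Y (Suc n)"
  let ?e = axis and ?f = normal
  note [measurable] = past_coordinates(1,3)[of b n] past_coordinates(2)[of n] running_past[of n]
  (* The coefficients of drift_inequality at the current position, switched off once the walk has stopped.
     All are bounded in terms of the height, so each product with a function of the next step is integrable. *)
  define c1 c2 c3 c4 c5 c6 where "c1 \<omega> = ?r \<omega> * ((1 + ln (?y \<omega>)) / 4 + (?m \<omega>)\<^sup>2)"
    and "c2 \<omega> = ?r \<omega> * (- 2 * ?m \<omega>)"
    and "c3 \<omega> = ?r \<omega> * ((1/4 - (?m \<omega>)\<^sup>2 / 2) / ?y \<omega>)"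
    and "c4 \<omega> = ?r \<omega> * (- 1 / (2 * ?y \<omega>))"
    and "c5 \<omega> = ?r \<omega> * (?m \<omega> / ?y \<omega>)"
    and "c6 \<omega> = ?r \<omega> * ((1 + T\<^sup>2) / (2 * ?y \<omega>))" for \<omega>
  have [measurable]: "c1 \<in> past n \<rightarrow>\<^sub>M borel" "c2 \<in> past n \<rightarrow>\<^sub>M borel" "c3 \<in> past n \<rightarrow>\<^sub>M borel"
    "c4 \<in> past n \<rightarrow>\<^sub>M borel" "c5 \<in> past n \<rightarrow>\<^sub>M borel" "c6 \<in> past n \<rightarrow>\<^sub>M borel"
    unfolding c1_def c2_def c3_def c4_def c5_def c6_def by measurable
  have divy: "\<bar>a / y\<bar> \<le> c + y" if "1 \<le> y" "\<bar>a\<bar> \<le> c" for a y c :: real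
  proof -
    have "\<bar>a / y\<bar> \<le> \<bar>a\<bar>" using that by (simp add: divide_le_eq mult_le_cancel_left1)
    then show ?thesis using that by linarith
  qed
  have ci1: "integrable M c1" unfolding c1_def
  proof (rule running_times_bounded_integrable[where c = "1 + T\<^sup>2"])
    fix \<omega> assume c: "1 \<le> ?y \<omega>" "(?m \<omega>)\<^sup>2 \<le> T\<^sup>2"
    then have "0 \<le> ln (?y \<omega>)" "ln (?y \<omega>) \<le> ?y \<omega> - 1" by (auto intro: ln_le_minus_one)
    moreover have "0 \<le> (?m \<omega>)\<^sup>2" by simp
    ultimately show "\<bar>(1 + ln (?y \<omega>)) / 4 + (?m \<omega>)\<^sup>2\<bar> \<le> (1 + T\<^sup>2) + ?y \<omega>"
      using c by (intro abs_leI) (simp_all add: field_simps)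
  qed measurable
  have ci2: "integrable M c2" unfolding c2_def
  proof (rule running_times_bounded_integrable[where c = "2 * T"])
    fix \<omega> assume "1 \<le> ?y \<omega>" "\<bar>?m \<omega>\<bar> \<le> T"
    then show "\<bar>- 2 * ?m \<omega>\<bar> \<le> 2 * T + ?y \<omega>" by linarith
  qed measurable
  have ci3: "integrable M c3" unfolding c3_def
  proof (rule running_times_bounded_integrable[where c = "1 + T\<^sup>2"])
    fix \<omega> assume c: "1 \<le> ?y \<omega>" "(?m \<omega>)\<^sup>2 \<le> T\<^sup>2"
    have "\<bar>1/4 - (?m \<omega>)\<^sup>2 / 2\<bar> \<le> 1 + T\<^sup>2" using c zero_le_power2[of "?m \<omega>"] by linarith
    then show "\<bar>(1/4 - (?m \<omega>)\<^sup>2 / 2) / ?y \<omega>\<bar> \<le> (1 + T\<^sup>2) + ?y \<omega>" by (rule divy[OF c(1)])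
  qed measurable
  have ci4: "integrable M c4" unfolding c4_def
  proof (rule running_times_bounded_integrable[where c = 1])
    fix \<omega> assume "1 \<le> ?y \<omega>"
    from divy[OF this, of "- 1 / 2" 1] show "\<bar>- 1 / (2 * ?y \<omega>)\<bar> \<le> 1 + ?y \<omega>" by simp
  qed measurable
  have ci5: "integrable M c5" unfolding c5_def
  proof (rule running_times_bounded_integrable[where c = T])
    fix \<omega> assume "1 \<le> ?y \<omega>" "\<bar>?m \<omega>\<bar> \<le> T"
    then show "\<bar>?m \<omega> / ?y \<omega>\<bar> \<le> T + ?y \<omega>" by (rule divy)
  qed measurable
  have ci6: "integrable M c6" unfolding c6_def
  proof (rule running_times_bounded_integrable[where c = "1 + T\<^sup>2"])
    fix \<omega> assume c: "1 \<le> ?y \<omega>"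
    have "\<bar>(1 + T\<^sup>2) / 2 / ?y \<omega>\<bar> \<le> (1 + T\<^sup>2) + ?y \<omega>" by (rule divy[OF c]) (simp add: abs_of_pos add_pos_nonneg)
    then show "\<bar>(1 + T\<^sup>2) / (2 * ?y \<omega>)\<bar> \<le> (1 + T\<^sup>2) + ?y \<omega>" by simp
  qed measurable
  have p1: "integrable M (\<lambda>\<omega>. c1 \<omega> * (?Y \<omega> \<bullet> ?e))" "expectation (\<lambda>\<omega>. c1 \<omega> * (?Y \<omega> \<bullet> ?e)) = 0"
    using past_times_step[of c1 n "\<lambda>v. v \<bullet> ?e"] ci1 by (auto simp: X_inner)
  have p2: "integrable M (\<lambda>\<omega>. c2 \<omega> * (?Y \<omega> \<bullet> ?f))" "expectation (\<lambda>\<omega>. c2 \<omega> * (?Y \<omega> \<bullet> ?f)) = 0"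
    using past_times_step[of c2 n "\<lambda>v. v \<bullet> ?f"] ci2 by (auto simp: X_inner)
  have p3: "integrable M (\<lambda>\<omega>. c3 \<omega> * (?Y \<omega> \<bullet> ?e)\<^sup>2)" "expectation (\<lambda>\<omega>. c3 \<omega> * (?Y \<omega> \<bullet> ?e)\<^sup>2) = expectation c3"
    using past_times_step[of c3 n "\<lambda>v. (v \<bullet> ?e)\<^sup>2"] ci3 by (auto simp: X_inner power2_eq_square orthonormal)
  have p4: "integrable M (\<lambda>\<omega>. c4 \<omega> * (?Y \<omega> \<bullet> ?f)\<^sup>2)" "expectation (\<lambda>\<omega>. c4 \<omega> * (?Y \<omega> \<bullet> ?f)\<^sup>2) = expectation c4"
    using past_times_step[of c4 n "\<lambda>v. (v \<bullet> ?f)\<^sup>2"] ci4 by (auto simp: X_inner power2_eq_square orthonormal)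
  have p5: "integrable M (\<lambda>\<omega>. c5 \<omega> * ((?Y \<omega> \<bullet> ?e) * (?Y \<omega> \<bullet> ?f)))" "expectation (\<lambda>\<omega>. c5 \<omega> * ((?Y \<omega> \<bullet> ?e) * (?Y \<omega> \<bullet> ?f))) = 0"
    using past_times_step[of c5 n "\<lambda>v. (v \<bullet> ?e) * (v \<bullet> ?f)"] ci5 by (auto simp: X_inner orthonormal)
  have p6: "integrable M (\<lambda>\<omega>. c6 \<omega> * tail b (?Y \<omega>))" "expectation (\<lambda>\<omega>. c6 \<omega> * tail b (?Y \<omega>)) = expectation c6 * \<delta>"
    using past_times_step[of c6 n "tail b"] ci6 tail_integrable by (auto simp: \<delta>_def)
  have "expectation (lyapunov b (Suc n)) \<le> expectation (\<lambda>\<omega>. lyapunov b n \<omega> + (c1 \<omega> * (?Y \<omega> \<bullet> ?e) + c2 \<omega> * (?Y \<omega> \<bullet> ?f)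
      + c3 \<omega> * (?Y \<omega> \<bullet> ?e)\<^sup>2 + c4 \<omega> * (?Y \<omega> \<bullet> ?f)\<^sup>2 + c5 \<omega> * ((?Y \<omega> \<bullet> ?e) * (?Y \<omega> \<bullet> ?f)) + c6 \<omega> * tail b (?Y \<omega>)))"
  proof (rule integral_mono_AE)
    show "AE \<omega> in M. lyapunov b (Suc n) \<omega> \<le> lyapunov b n \<omega> + (c1 \<omega> * (?Y \<omega> \<bullet> ?e) + c2 \<omega> * (?Y \<omega> \<bullet> ?f)
      + c3 \<omega> * (?Y \<omega> \<bullet> ?e)\<^sup>2 + c4 \<omega> * (?Y \<omega> \<bullet> ?f)\<^sup>2 + c5 \<omega> * ((?Y \<omega> \<bullet> ?e) * (?Y \<omega> \<bullet> ?f)) + c6 \<omega> * tail b (?Y \<omega>))"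
      using coordinate_bounds[OF b]
    proof eventually_elim
      case (elim \<omega>)
      show ?case
      proof (cases "Z n \<omega> \<in> K")
        case True
        have y': "height b (Suc n) \<omega> = ?y \<omega> + ?Y \<omega> \<bullet> ?e" and w': "offset (Suc n) \<omega> = ?w \<omega> + ?Y \<omega> \<bullet> ?f"
          using True by (simp_all add: height_def offset_def inner_add_left)
        have r: "?r \<omega> = 1" using True by (simp add: running_def)
        have by_n: "b \<le> ?y \<omega>" and "1 \<le> ?y \<omega>" "1 \<le> height b (Suc n) \<omega>" and w: "\<bar>?w \<omega>\<bar> \<le> T * ?y \<omega>"
          using elim by blast+
        then have "0 < ?y \<omega>" "0 < ?y \<omega> + ?Y \<omega> \<bullet> ?e" unfolding y' by linarith+
        note drift = drift_inequality[OF this(1) by_n this(2) w, of "?Y \<omega> \<bullet> ?f", folded slope_def]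
        have coefficients: "c1 \<omega> = (1 + ln (?y \<omega>)) / 4 + (?m \<omega>)\<^sup>2" "t + c2 \<omega> * s = t - 2 * ?m \<omega> * s"
          "c3 \<omega> = (1/4 - (?m \<omega>)\<^sup>2 / 2) / ?y \<omega>" "t + c4 \<omega> * s = t - 1 / (2 * ?y \<omega>) * s"
          "c5 \<omega> = ?m \<omega> / ?y \<omega>" "c6 \<omega> = (1 + T\<^sup>2) / (2 * ?y \<omega>)" for s t
          by (simp_all only: c1_def c2_def c3_def c4_def c5_def c6_def r mult_1_left
              mult_minus_left divide_minus_left diff_conv_add_uminus)
        show ?thesis
          unfolding lyapunov_def y' w' coefficients tail_def by (rule drift)
      next
        case False
        then have "?r \<omega> = 0" "lyapunov b (Suc n) \<omega> = lyapunov b n \<omega>"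
          by (auto simp: running_def lyapunov_def height_def offset_def)
        then show ?thesis by (simp add: c1_def c2_def c3_def c4_def c5_def c6_def)
      qed
    qed
  qed (intro Bochner_Integration.integrable_add lyapunov_integrable p1 p2 p3 p4 p5 p6)+
  also have "\<dots> = expectation (lyapunov b n) + (expectation c3 + expectation c4 + expectation c6 * \<delta>)"
    by (simp only: Bochner_Integration.integral_add Bochner_Integration.integrable_add
        p1 p2 p3 p4 p5 p6 lyapunov_integrable add_0_left add_0_right)
  also have "expectation c3 + expectation c4 + expectation c6 * \<delta> = expectation (\<lambda>\<omega>. c3 \<omega> + c4 \<omega> + c6 \<omega> * \<delta>)"
    by (simp add: ci3 ci4 ci6)
  also have "\<dots> \<le> expectation (\<lambda>\<omega>. 0)"
  proof (rule integral_mono_AE)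
    show "AE \<omega> in M. c3 \<omega> + c4 \<omega> + c6 \<omega> * \<delta> \<le> 0"
      using coordinate_bounds[OF b]
    proof eventually_elim
      case (elim \<omega>)
      then have c: "1 \<le> ?y \<omega>" by blast
      have "c3 \<omega> + c4 \<omega> + c6 \<omega> * \<delta> = ?r \<omega> / ?y \<omega> * (1/4 - (?m \<omega>)\<^sup>2 / 2 - 1/2 + (1 + T\<^sup>2) * \<delta> / 2)"
        using c by (simp add: c3_def c4_def c6_def field_simps)
      moreover have "1/4 - (?m \<omega>)\<^sup>2 / 2 - 1/2 + (1 + T\<^sup>2) * \<delta> / 2 \<le> 0"
        using tail[folded \<delta>_def] zero_le_power2[of "?m \<omega>"] by linarith
      moreover have "0 \<le> ?r \<omega> / ?y \<omega>" using c running_bounds[of n \<omega>] by simp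
      ultimately show ?case by (metis mult_nonneg_nonpos)
    qed
  qed (simp_all add: ci3 ci4 ci6)
  finally show ?thesis by simp
qed

text \<open>Since \<open>w\<^sup>2 / y \<le> T\<^sup>2 y\<close> and the mean of the height is constant in time, the upper bound on the mean of
\<open>lyapunov\<close> turns into one on the mean of \<open>y ln y\<close>.\<close>
lemma height_log_bounded:
  assumes tail: "(1 + T\<^sup>2) * expectation (\<lambda>\<omega>. tail b (X \<omega>)) \<le> 1 / 2"
  shows "\<exists>C\<ge>0. \<forall>n. expectation (\<lambda>\<omega>. height b n \<omega> * ln (height b n \<omega>)) \<le> C"
proof -
  define C where "C = 4 * (expectation (lyapunov b 0) + T\<^sup>2 * (x \<bullet> axis + b))"
  have le: "expectation (\<lambda>\<omega>. height b n \<omega> * ln (height b n \<omega>)) \<le> C" for n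
  proof -
    have "expectation (lyapunov b n) \<le> expectation (lyapunov b 0)"
      by (induction n) (auto intro: order_trans[OF lyapunov_step[OF tail]])
    moreover have "expectation (lyapunov b n)
        = expectation (\<lambda>\<omega>. height b n \<omega> * ln (height b n \<omega>)) / 4 - expectation (\<lambda>\<omega>. (offset n \<omega>)\<^sup>2 / height b n \<omega>)"
      unfolding lyapunov_def
      by (subst Bochner_Integration.integral_diff) (auto intro: height_log_integrable offset_ratio_integrable)
    moreover have "expectation (\<lambda>\<omega>. (offset n \<omega>)\<^sup>2 / height b n \<omega>) \<le> expectation (\<lambda>\<omega>. T\<^sup>2 * height b n \<omega>)"
      by (rule integral_mono_AE[OF offset_ratio_integrable])
        (use offset_ratio_bound[of n] height_integrable in auto)
    ultimately show ?thesis unfolding C_def by (simp add: height_mean)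
  qed
  moreover have "0 \<le> C" using order_trans[OF integral_nonneg_AE[OF height_log_nonneg] le[of 0]] .
  ultimately show ?thesis by blast
qed

lemma component_le_height: "AE \<omega> in M. \<bar>Z n \<omega> $ i\<bar> \<le> (1 + T) * height b n \<omega>"
  using coordinate_bounds[OF b]
proof eventually_elim
  case (elim \<omega>)
  then have "b \<le> height b n \<omega>" "\<bar>offset n \<omega>\<bar> \<le> T * height b n \<omega>" by blast+
  moreover have "\<bar>Z n \<omega> $ i\<bar> \<le> \<bar>Z n \<omega> \<bullet> axis\<bar> + \<bar>Z n \<omega> \<bullet> normal\<bar>"
    using component_le_norm_cart norm_le_frame by (rule order_trans)
  ultimately show ?case using b unfolding height_def offset_def by (simp add: algebra_simps)
qed

end

text \<open>All coordinates are at most \<open>(1 + T) y\<close>, and by \<open>superlinear_bound\<close> this is a constant plus a small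
multiple of \<open>y ln y\<close>, whose mean is bounded.\<close>
lemma first_moment_of_limit:
  assumes B[measurable]: "B \<in> borel_measurable M"
    and lim: "AE \<omega> in M. (\<lambda>n. Z n \<omega>) \<longlonglongrightarrow> B \<omega>"
  shows "integrable M (\<lambda>\<omega>. B \<omega> $ i) \<and> expectation (\<lambda>\<omega>. B \<omega> $ i) = x $ i"
proof -
  obtain b where b: "1 \<le> b" and tail: "(1 + T\<^sup>2) * expectation (\<lambda>\<omega>. tail b (X \<omega>)) \<le> 1 / 2"
    using tail_small by blast
  obtain C where C: "0 \<le> C" "\<And>n. expectation (\<lambda>\<omega>. height b n \<omega> * ln (height b n \<omega>)) \<le> C"
    using height_log_bounded[OF b tail] by blast
  have "integrable M (\<lambda>\<omega>. B \<omega> $ i) \<and> (\<lambda>n. expectation (\<lambda>\<omega>. Z n \<omega> $ i)) \<longlonglongrightarrow> expectation (\<lambda>\<omega>. B \<omega> $ i)"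
  proof (rule expectation_tendsto_of_uniformly_integrable)
    show "integrable M (\<lambda>\<omega>. Z n \<omega> $ i)" for n by (rule Z_integrable)
    show "(\<lambda>\<omega>. B \<omega> $ i) \<in> borel_measurable M" by measurable
    show "AE \<omega> in M. (\<lambda>n. Z n \<omega> $ i) \<longlonglongrightarrow> B \<omega> $ i"
      using lim by eventually_elim (intro tendsto_intros)
    fix \<epsilon> :: real assume \<epsilon>: "0 < \<epsilon>"
    (* Chosen so that (1 + T) * d * C is at most \<epsilon>; C + 1 avoids a division by zero. *)
    define d where "d = \<epsilon> / ((1 + T) * (C + 1))"
    have d: "0 < d" using \<epsilon> T C by (simp add: d_def)
    have dC: "(1 + T) * d * C \<le> \<epsilon>"
    proof -
      have "(1 + T) * d * C \<le> (1 + T) * d * (C + 1)" using T d by (intro mult_left_mono) auto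
      also have "\<dots> = d * ((1 + T) * (C + 1))" by (simp only: mult_ac)
      also have "\<dots> = \<epsilon>" using T C by (simp add: d_def)
      finally show ?thesis .
    qed
    define \<Phi> where "\<Phi> n \<omega> = (1 + T) * d * (height b n \<omega> * ln (height b n \<omega>))" for n \<omega>
    have mean: "expectation (\<Phi> n) \<le> \<epsilon>" for n
    proof -
      have "expectation (\<Phi> n) = (1 + T) * d * expectation (\<lambda>\<omega>. height b n \<omega> * ln (height b n \<omega>))"
        unfolding \<Phi>_def by simp
      also have "\<dots> \<le> (1 + T) * d * C" using T d C(2) by (intro mult_left_mono) auto
      finally show ?thesis using dC by simp
    qed
    have int: "integrable M (\<Phi> n)" for n unfolding \<Phi>_def by (intro integrable_mult_right height_log_integrable b)
    have bound: "AE \<omega> in M. 0 \<le> \<Phi> n \<omega> \<and> \<bar>Z n \<omega> $ i\<bar> \<le> (1 + T) * exp (1 / d) + \<Phi> n \<omega>" for n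
      using height_log_nonneg[OF b, of n] component_le_height[OF b, of n i] coordinate_bounds[OF b]
    proof eventually_elim
      case (elim \<omega>)
      then have "1 \<le> height b n \<omega>" by blast
      from superlinear_bound[OF d this]
      have "(1 + T) * height b n \<omega> \<le> (1 + T) * (exp (1 / d) + d * (height b n \<omega> * ln (height b n \<omega>)))"
        using T by (intro mult_left_mono) auto
      also have "\<dots> = (1 + T) * exp (1 / d) + \<Phi> n \<omega>" by (simp add: \<Phi>_def algebra_simps)
      finally have "\<bar>Z n \<omega> $ i\<bar> \<le> (1 + T) * exp (1 / d) + \<Phi> n \<omega>" using elim(2) by linarith
      moreover have "0 \<le> \<Phi> n \<omega>" unfolding \<Phi>_def using T d by (intro mult_nonneg_nonneg[OF _ elim(1)]) auto
      ultimately show ?case by blast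
    qed
    show "\<exists>G. integrable M G \<and> (\<forall>\<omega>. 0 \<le> G \<omega>) \<and>
       (\<forall>\<^sub>F n in sequentially. \<exists>\<Phi>. integrable M \<Phi> \<and> expectation \<Phi> \<le> \<epsilon> \<and>
          (AE \<omega> in M. 0 \<le> \<Phi> \<omega> \<and> \<bar>Z n \<omega> $ i\<bar> \<le> G \<omega> + \<Phi> \<omega>))"
    proof (rule exI[of _ "\<lambda>_. (1 + T) * exp (1 / d)"], intro conjI)
      show "\<forall>\<omega>. 0 \<le> (1 + T) * exp (1 / d)" using T by simp
      show "\<forall>\<^sub>F n in sequentially. \<exists>\<Phi>. integrable M \<Phi> \<and> expectation \<Phi> \<le> \<epsilon> \<and>
          (AE \<omega> in M. 0 \<le> \<Phi> \<omega> \<and> \<bar>Z n \<omega> $ i\<bar> \<le> (1 + T) * exp (1 / d) + \<Phi> \<omega>)"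
        using int mean bound by (intro always_eventually) blast
    qed simp
  qed
  then show ?thesis by (auto simp: Z_mean LIMSEQ_const_iff)
qed

end

section \<open>The exit position\<close>

lemma exit_time_infinite:
  assumes "\<nexists>n. 1 \<le> n \<and> x + S n \<omega> \<notin> K"
  shows "exit_time K S x \<omega> = \<infinity>"
proof -
  have "{n. 1 \<le> n \<and> x + S n \<omega> \<notin> K} = {}" using assms by auto
  then show ?thesis unfolding exit_time_def by (simp only: image_empty Inf_empty top_enat_def)
qed

lemma exit_time_finite:
  assumes "\<exists>n. 1 \<le> n \<and> x + S n \<omega> \<notin> K"
  shows "exit_time K S x \<omega> = enat (LEAST n. 1 \<le> n \<and> x + S n \<omega> \<notin> K)"
  unfolding exit_time_def
proof (rule Inf_eqI)
  let ?t = "LEAST n. 1 \<le> n \<and> x + S n \<omega> \<notin> K"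
  have t: "1 \<le> ?t \<and> x + S ?t \<omega> \<notin> K" using assms by (rule LeastI_ex)
  show "enat ?t \<le> i" if "i \<in> enat ` {n. 1 \<le> n \<and> x + S n \<omega> \<notin> K}" for i
    using that by (auto intro: Least_le)
  show "y \<le> enat ?t" if "\<And>i. i \<in> enat ` {n. 1 \<le> n \<and> x + S n \<omega> \<notin> K} \<Longrightarrow> y \<le> i" for y
    by (rule that, rule imageI) (use t in blast)
qed

text \<open>On paths that never leave \<open>K\<close> the exit position is the position at the fixed index \<open>the_enat \<infinity>\<close>,
so it is measurable everywhere and not only up to a null set.\<close>
lemma exit_position_measurable:
  assumes [measurable]: "\<And>n. S n \<in> borel_measurable M" "K \<in> sets borel"
  shows "exit_position K S x \<in> borel_measurable M"
proof -
  let ?P = "\<lambda>n \<omega>. 1 \<le> n \<and> x + S n \<omega> \<notin> K"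
  define k where "k \<omega> = (if \<exists>n. ?P n \<omega> then LEAST n. ?P n \<omega> else the_enat \<infinity>)" for \<omega>
  have "the_enat (exit_time K S x \<omega>) = k \<omega>" for \<omega>
  proof (cases "\<exists>n. ?P n \<omega>")
    case True
    then show ?thesis using exit_time_finite[of x S \<omega> K, OF True] by (simp only: k_def the_enat.simps if_True)
  next
    case False
    then show ?thesis using exit_time_infinite[of x S \<omega> K, OF False] by (simp only: k_def if_False)
  qed
  then have eq: "exit_position K S x = (\<lambda>\<omega>. x + S (k \<omega>) \<omega>)"
    by (simp add: exit_position_def fun_eq_iff)
  have [measurable]: "Measurable.pred M (?P n)" for n by measurable
  have "k \<in> measurable M (count_space UNIV)"
    unfolding k_def by measurable
  then show ?thesis unfolding eq
    by (rule measurable_compose_countable[where f = "\<lambda>i \<omega>. x + S i \<omega>", rotated]) measurable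
qed

lemma stopped_exit:
  assumes x: "x \<in> K" and fin: "exit_time K (walk Y) x \<omega> < \<infinity>"
  shows "\<forall>n. stopped K Y x n \<omega> \<in> K \<or> stopped K Y x n \<omega> = exit_position K (walk Y) x \<omega>"
    and "\<forall>\<^sub>F n in sequentially. stopped K Y x n \<omega> = exit_position K (walk Y) x \<omega>"
proof -
  define t where "t = (LEAST n. 1 \<le> n \<and> x + walk Y n \<omega> \<notin> K)"
  have ex: "\<exists>n. 1 \<le> n \<and> x + walk Y n \<omega> \<notin> K"
  proof (rule ccontr)
    assume "\<not> ?thesis"
    then have "exit_time K (walk Y) x \<omega> = \<infinity>" by (rule exit_time_infinite)
    then show False using fin by (simp only: less_irrefl)
  qed
  have "1 \<le> t \<and> x + walk Y t \<omega> \<notin> K" unfolding t_def by (rule LeastI_ex[OF ex])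
  then have t: "1 \<le> t" "x + walk Y t \<omega> \<notin> K" by blast+
  have pos: "exit_position K (walk Y) x \<omega> = x + walk Y t \<omega>"
    unfolding exit_position_def exit_time_finite[of x "walk Y" \<omega> K, OF ex] t_def by (simp only: the_enat.simps)
  have inside: "x + walk Y n \<omega> \<in> K" if "n < t" for n
  proof (cases "n = 0")
    case True then show ?thesis using x by (simp add: walk_def)
  next
    case False
    then have "1 \<le> n" by simp
    with not_less_Least[OF that[unfolded t_def]] show ?thesis by blast
  qed
  have before: "stopped K Y x n \<omega> = x + walk Y n \<omega>" if "n \<le> t" for n
    using that
  proof (induction n)
    case 0 then show ?case by (simp add: walk_def)
  next
    case (Suc n)
    then show ?case using inside[of n] by (simp add: walk_def)
  qed
  have after: "stopped K Y x n \<omega> = x + walk Y t \<omega>" if "t \<le> n" for n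
    using that
  proof (induction n rule: dec_induct)
    case base then show ?case by (rule before) simp
  next
    case (step n) then show ?case using t by simp
  qed
  show "\<forall>n. stopped K Y x n \<omega> \<in> K \<or> stopped K Y x n \<omega> = exit_position K (walk Y) x \<omega>"
    using before inside after unfolding pos by (metis less_or_eq_imp_le not_le)
  show "\<forall>\<^sub>F n in sequentially. stopped K Y x n \<omega> = exit_position K (walk Y) x \<omega>"
    unfolding pos using after by (intro eventually_sequentiallyI)
qed

text \<open>Leaving the wedge through its frontier is what confines the stopped path to the closed wedge, where
the cone condition holds and the quadratic form of the second moments is nonnegative.\<close>
locale skip_free_wedge_walk = stopped_planar_walk M X Y "wedge \<alpha>" x
  for M :: "'a measure" and X Y \<alpha> x +
  assumes angle: "0 < \<alpha>" "\<alpha> < pi" and start: "x \<in> wedge \<alpha>"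
    and exits: "AE \<omega> in M. exit_time (wedge \<alpha>) (walk Y) x \<omega> < \<infinity> \<and>
                      exit_position (wedge \<alpha>) (walk Y) x \<omega> \<in> frontier (wedge \<alpha>)"
begin

abbreviation "Exit \<equiv> exit_position (wedge \<alpha>) (walk Y) x"

lemma Exit_measurable: "Exit \<in> borel_measurable M"
  by (rule exit_position_measurable)
    (auto simp: walk_def[abs_def] intro!: borel_measurable_sum Y_measurable)

lemma Z_tendsto_Exit: "AE \<omega> in M. (\<lambda>n. Z n \<omega>) \<longlonglongrightarrow> Exit \<omega>"
  using exits by eventually_elim (rule tendsto_eventually, rule stopped_exit(2)[OF start], blast)

lemma Z_in_closure: "AE \<omega> in M. \<forall>n. Z n \<omega> \<in> closure (wedge \<alpha>)"
  using exits
proof eventually_elim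
  case (elim \<omega>)
  then have "Exit \<omega> \<in> closure (wedge \<alpha>)" by (simp add: frontier_def)
  moreover have "\<forall>n. Z n \<omega> \<in> wedge \<alpha> \<or> Z n \<omega> = Exit \<omega>"
    by (rule stopped_exit(1)[OF start]) (use elim in blast)
  ultimately show ?case using closure_subset[of "wedge \<alpha>"] by (metis subsetD)
qed

lemma exit_mean: "integrable M (\<lambda>\<omega>. Exit \<omega> $ i) \<and> expectation (\<lambda>\<omega>. Exit \<omega> $ i) = x $ i"
proof -
  interpret walk_in_cone M X Y "wedge \<alpha>" x "\<alpha> / 2" "1 / cos (\<alpha>/2)"
  proof
    show "0 < 1 / cos (\<alpha>/2)" using angle by (simp add: cos_gt_zero_pi)
    show "AE \<omega> in M. \<forall>n. \<bar>Z n \<omega> \<bullet> vector [- sin (\<alpha>/2), cos (\<alpha>/2)]\<bar>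
        \<le> 1 / cos (\<alpha>/2) * (Z n \<omega> \<bullet> vector [cos (\<alpha>/2), sin (\<alpha>/2)])"
      using Z_in_closure by eventually_elim (use closure_wedge_axis[OF angle] in simp)
  qed
  show ?thesis by (rule first_moment_of_limit[OF Exit_measurable Z_tendsto_Exit])
qed

text \<open>The form \<open>u\<close> is nonnegative on the closed wedge, which bounds the clock, and zero on the frontier, which
determines the limit of the clock.\<close>
lemma exit_second_moment:
  assumes acute: "\<alpha> < pi / 2"
  shows "integrable M (\<lambda>\<omega>. (Exit \<omega> $ i)\<^sup>2) \<and>
    expectation (\<lambda>\<omega>. (Exit \<omega> $ i)\<^sup>2) = (x $ i)\<^sup>2 + x $ 2 * (x $ 1 * tan \<alpha> - x $ 2)"
proof -
  define u where "u z = tan \<alpha> * (z $ 1 * z $ 2) - z $ 2 * z $ 2" for z :: "real^2"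
  have cos: "0 < cos \<alpha>" using angle acute by (intro cos_gt_zero) auto
  have u: "u z = z $ 2 * (z $ 1 * sin \<alpha> - z $ 2 * cos \<alpha>) / cos \<alpha>" for z
    using cos by (simp add: u_def tan_def field_simps)
  have "clock n \<le> u x" for n
  proof -
    have "0 \<le> expectation (\<lambda>\<omega>. u (Z n \<omega>))"
    proof (rule integral_nonneg_AE, use Z_in_closure in eventually_elim)
      fix \<omega> assume "\<forall>n. Z n \<omega> \<in> closure (wedge \<alpha>)"
      then show "0 \<le> u (Z n \<omega>)" unfolding u using closure_wedge[OF angle, of "Z n \<omega>"] cos by simp
    qed
    also have "\<dots> = u x - clock n"
      unfolding u_def by (simp add: ZZ_integrable ZZ_mean)
    finally show ?thesis by simp
  qed
  from second_moments_of_limit[OF Exit_measurable Z_tendsto_Exit this]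
  obtain L where L: "\<And>i j. integrable M (\<lambda>\<omega>. Exit \<omega> $ i * Exit \<omega> $ j)"
     "\<And>i j. expectation (\<lambda>\<omega>. Exit \<omega> $ i * Exit \<omega> $ j) = x $ i * x $ j + (if i = j then L else 0)"
    by blast
  have "expectation (\<lambda>\<omega>. u (Exit \<omega>)) = expectation (\<lambda>\<omega>. 0)"
  proof (rule integral_cong_AE)
    show "AE \<omega> in M. u (Exit \<omega>) = 0"
      using exits unfolding u by eventually_elim (use frontier_wedge[OF angle] in simp)
    note [measurable] = Exit_measurable
    show "(\<lambda>\<omega>. u (Exit \<omega>)) \<in> borel_measurable M" unfolding u_def by measurable
  qed simp
  moreover have "expectation (\<lambda>\<omega>. u (Exit \<omega>)) = u x - L"
    unfolding u_def by (simp add: L)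
  ultimately have "L = x $ 2 * (x $ 1 * tan \<alpha> - x $ 2)" by (simp add: u_def algebra_simps)
  then show ?thesis using L[of i i] by (simp add: power2_eq_square)
qed

end

theorem corollary20:
  fixes M :: "'a measure"
    and X :: "'a \<Rightarrow> real^2"
    and Y :: "nat \<Rightarrow> 'a \<Rightarrow> real^2"
    and S :: "nat \<Rightarrow> 'a \<Rightarrow> real^2"
    and R :: "(real^2) set"
    and \<alpha> :: real
  assumes "prob_space M"
    and "X \<in> borel_measurable M"
    and "\<And>i. integrable M (\<lambda>\<omega>. X \<omega> $ i)"
    and "\<And>i. prob_space.expectation M (\<lambda>\<omega>. X \<omega> $ i) = 0"
    and "\<And>i j. integrable M (\<lambda>\<omega>. X \<omega> $ i * X \<omega> $ j)"
    and "\<And>i j. prob_space.expectation M (\<lambda>\<omega>. X \<omega> $ i * X \<omega> $ j) = (if i = j then 1 else 0)"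
    and "prob_space.indep_vars M (\<lambda>_. borel) Y {1..}"
    and "\<And>n. 1 \<le> n \<Longrightarrow> distr M borel (Y n) = distr M borel X"
    and "S = walk Y"
    and "planar_lattice R"
    and "AE \<omega> in M. \<forall>n. S n \<omega> \<in> R"
    and "\<And>x. x \<in> R \<inter> wedge \<alpha> \<Longrightarrow>
           AE \<omega> in M. exit_time (wedge \<alpha>) S x \<omega> < \<infinity> \<and>
                      exit_position (wedge \<alpha>) S x \<omega> \<in> frontier (wedge \<alpha>)"
  shows "(0 < \<alpha> \<and> \<alpha> < pi \<longrightarrow>
           (\<forall>x \<in> wedge \<alpha> \<inter> R. \<forall>i.
              integrable M (\<lambda>\<omega>. exit_position (wedge \<alpha>) S x \<omega> $ i) \<and>
              prob_space.expectation M (\<lambda>\<omega>. exit_position (wedge \<alpha>) S x \<omega> $ i) = x $ i)) \<and>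
         (0 < \<alpha> \<and> \<alpha> < pi / 2 \<longrightarrow>
           (\<forall>x \<in> wedge \<alpha> \<inter> R. \<forall>i.
              integrable M (\<lambda>\<omega>. (exit_position (wedge \<alpha>) S x \<omega> $ i)\<^sup>2) \<and>
              prob_space.expectation M (\<lambda>\<omega>. (exit_position (wedge \<alpha>) S x \<omega> $ i)\<^sup>2)
                = (x $ i)\<^sup>2 + x $ 2 * (x $ 1 * tan \<alpha> - x $ 2)))"
proof -
  have walk: "skip_free_wedge_walk M X Y \<alpha> x"
    if "0 < \<alpha>" "\<alpha> < pi" "x \<in> wedge \<alpha> \<inter> R" for x
  proof -
    have "standard_planar_walk M X Y"
      by (intro standard_planar_walk.intro standard_planar_walk_axioms.intro assms(1-8))
    then have "stopped_planar_walk M X Y (wedge \<alpha>)"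
      using open_wedge[OF that(1,2)]
      by (intro stopped_planar_walk.intro stopped_planar_walk_axioms.intro) auto
    then show ?thesis
      using that assms(12)[of x] unfolding \<open>S = walk Y\<close>
      by (intro skip_free_wedge_walk.intro skip_free_wedge_walk_axioms.intro) auto
  qed
  show ?thesis
    unfolding \<open>S = walk Y\<close>
  proof (intro conjI[of "_ \<longrightarrow> _"] impI ballI allI)
    fix x i assume "0 < \<alpha> \<and> \<alpha> < pi" and x: "x \<in> wedge \<alpha> \<inter> R"
    then interpret skip_free_wedge_walk M X Y \<alpha> x by (intro walk) auto
    show "integrable M (\<lambda>\<omega>. exit_position (wedge \<alpha>) (walk Y) x \<omega> $ i) \<and>
        expectation (\<lambda>\<omega>. exit_position (wedge \<alpha>) (walk Y) x \<omega> $ i) = x $ i"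
      by (rule exit_mean)
  next
    fix x i assume \<alpha>: "0 < \<alpha> \<and> \<alpha> < pi / 2" and x: "x \<in> wedge \<alpha> \<inter> R"
    then interpret skip_free_wedge_walk M X Y \<alpha> x using pi_gt_zero by (intro walk) (linarith, linarith, blast)
    show "integrable M (\<lambda>\<omega>. (exit_position (wedge \<alpha>) (walk Y) x \<omega> $ i)\<^sup>2) \<and>
        expectation (\<lambda>\<omega>. (exit_position (wedge \<alpha>) (walk Y) x \<omega> $ i)\<^sup>2)
          = (x $ i)\<^sup>2 + x $ 2 * (x $ 1 * tan \<alpha> - x $ 2)"
      by (rule exit_second_moment) (use \<alpha> in blast)
  qed
qed

end
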